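(* Let $B$ be a Boolean algebra and let $\mu_0:B\to[0,1]$ be an additive function. Then there exists a morphism of Boolean algebras $\beta:B\to\widetilde B$, where $\widetilde B$ is a reduced abstract $\sigma$-algebra with a measure $\widetilde\mu$, such that $\widetilde B$ is generated (as an abstract $\sigma$-algebra) by the image of $\beta$, and $\widetilde\mu\circ\beta=\mu_0$. Moreover this is unique up to unique isomorphism: if $(\beta_1:B\to\widetilde B_1,\widetilde\mu_1)$ and $(\beta_2:B\to\widetilde B_2,\widetilde\mu_2)$ both have these properties, there is a unique isomorphism of abstract $\sigma$-algebras $\phi:\widetilde B_1\to\widetilde B_2$ with $\phi\circ\beta_1=\beta_2$ and $\widetilde\mu_2\circ\phi=\widetilde\mu_1$.
   Context: An abstract $\sigma$-algebra is a Boolean algebra in which all countable joins exist (the trivial Boolean algebra with $0=1$ is allowed). A morphism of abstract $\sigma$-algebras is a map preserving order, $0$, $1$, complements and countable joins (hence also countable meets). An additive function on a Boolean algebra $B$ is a function $\mu_0:B\to[0,\infty]$ with $\mu_0(0)=0$ and $\mu_0(a\vee b)=\mu_0(a)+\mu_0(b)$ whenever $a\wedge b=0$. A measure on an abstract $\sigma$-algebra $\Sigma$ is a function $\mu:\Sigma\to[0,\infty]$ with $\mu(0)=0$ and $\mu(\bigvee_{i=0}^\infty a_i)=\sum_{i=0}^\infty\mu(a_i)$ whenever $a_i\wedge a_j=0$ for all $i\ne j$. An abstract $\sigma$-algebra $\Sigma$ with a measure $\mu$ is reduced if $\mu(a)=0$ implies $a=0$. An abstract $\sigma$-algebra is generated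 by a subset if it has no proper subset containing the given subset and closed under $0,1$, complements and countable joins. *)

theory Defs
  imports
    "HOL-Algebra.Lattice"
    "HOL-Library.Countable_Set"
    "HOL-Library.Extended_Nonnegative_Real"
begin

text \<open>
  Algebras are ordered structures with an explicit carrier, so that one statement can assert
  the existence of an algebra and quantify over others. The case \<open>\<bottom> = \<top>\<close> is not excluded.
\<close>

locale boolean_lattice = bounded_lattice +
  assumes meet_join_distrib:
      "\<lbrakk>x \<in> carrier L; y \<in> carrier L; z \<in> carrier L\<rbrakk>
        \<Longrightarrow> x \<sqinter> (y \<squnion> z) = (x \<sqinter> y) \<squnion> (x \<sqinter> z)"
    and complement_exists:
      "x \<in> carrier L \<Longrightarrow> \<exists>y\<in>carrier L. x \<sqinter> y = \<bottom> \<and> x \<squnion> y = \<top>"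

definition complement :: "('a, 'm) gorder_scheme \<Rightarrow> 'a \<Rightarrow> 'a" where
  "complement L x =
    (THE y. y \<in> carrier L \<and> x \<sqinter>\<^bsub>L\<^esub> y = \<bottom>\<^bsub>L\<^esub> \<and> x \<squnion>\<^bsub>L\<^esub> y = \<top>\<^bsub>L\<^esub>)"

locale abstract_sigma_algebra = boolean_lattice +
  assumes countable_sup_exists:
    "\<lbrakk>A \<subseteq> carrier L; countable A\<rbrakk> \<Longrightarrow> \<exists>s. least L s (Upper L A)"

definition boolean_hom ::
    "('a, 'm) gorder_scheme \<Rightarrow> ('b, 'n) gorder_scheme \<Rightarrow> ('a \<Rightarrow> 'b) \<Rightarrow> bool" where
  "boolean_hom L M f \<longleftrightarrow>
    f \<in> carrier L \<rightarrow> carrier M \<and>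
    f \<bottom>\<^bsub>L\<^esub> = \<bottom>\<^bsub>M\<^esub> \<and> f \<top>\<^bsub>L\<^esub> = \<top>\<^bsub>M\<^esub> \<and>
    (\<forall>x\<in>carrier L. f (complement L x) = complement M (f x)) \<and>
    (\<forall>x\<in>carrier L. \<forall>y\<in>carrier L.
      f (x \<squnion>\<^bsub>L\<^esub> y) = f x \<squnion>\<^bsub>M\<^esub> f y \<and> f (x \<sqinter>\<^bsub>L\<^esub> y) = f x \<sqinter>\<^bsub>M\<^esub> f y)"

definition sigma_hom ::
    "('a, 'm) gorder_scheme \<Rightarrow> ('b, 'n) gorder_scheme \<Rightarrow> ('a \<Rightarrow> 'b) \<Rightarrow> bool" where
  "sigma_hom L M f \<longleftrightarrow>
    f \<in> carrier L \<rightarrow> carrier M \<and>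
    (\<forall>x\<in>carrier L. \<forall>y\<in>carrier L. x \<sqsubseteq>\<^bsub>L\<^esub> y \<longrightarrow> f x \<sqsubseteq>\<^bsub>M\<^esub> f y) \<and>
    f \<bottom>\<^bsub>L\<^esub> = \<bottom>\<^bsub>M\<^esub> \<and> f \<top>\<^bsub>L\<^esub> = \<top>\<^bsub>M\<^esub> \<and>
    (\<forall>x\<in>carrier L. f (complement L x) = complement M (f x)) \<and>
    (\<forall>A. A \<subseteq> carrier L \<and> countable A \<longrightarrow> f (\<Squnion>\<^bsub>L\<^esub> A) = \<Squnion>\<^bsub>M\<^esub> (f ` A))"

definition sigma_iso ::
    "('a, 'm) gorder_scheme \<Rightarrow> ('b, 'n) gorder_scheme \<Rightarrow> ('a \<Rightarrow> 'b) \<Rightarrow> bool" where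
  "sigma_iso L M f \<longleftrightarrow>
    sigma_hom L M f \<and>
    (\<exists>g. sigma_hom M L g \<and> (\<forall>x\<in>carrier L. g (f x) = x) \<and> (\<forall>y\<in>carrier M. f (g y) = y))"

definition additive_on :: "('a, 'm) gorder_scheme \<Rightarrow> ('a \<Rightarrow> ennreal) \<Rightarrow> bool" where
  "additive_on L \<mu> \<longleftrightarrow>
    \<mu> \<bottom>\<^bsub>L\<^esub> = 0 \<and>
    (\<forall>x\<in>carrier L. \<forall>y\<in>carrier L. x \<sqinter>\<^bsub>L\<^esub> y = \<bottom>\<^bsub>L\<^esub> \<longrightarrow> \<mu> (x \<squnion>\<^bsub>L\<^esub> y) = \<mu> x + \<mu> y)"

definition abstract_measure :: "('a, 'm) gorder_scheme \<Rightarrow> ('a \<Rightarrow> ennreal) \<Rightarrow> bool" where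
  "abstract_measure L \<mu> \<longleftrightarrow>
    \<mu> \<bottom>\<^bsub>L\<^esub> = 0 \<and>
    (\<forall>a :: nat \<Rightarrow> 'a. range a \<subseteq> carrier L \<and> (\<forall>i j. i \<noteq> j \<longrightarrow> a i \<sqinter>\<^bsub>L\<^esub> a j = \<bottom>\<^bsub>L\<^esub>) \<longrightarrow>
      \<mu> (\<Squnion>\<^bsub>L\<^esub> (range a)) = (\<Sum>i. \<mu> (a i)))"

definition reduced :: "('a, 'm) gorder_scheme \<Rightarrow> ('a \<Rightarrow> ennreal) \<Rightarrow> bool" where
  "reduced L \<mu> \<longleftrightarrow> (\<forall>x\<in>carrier L. \<mu> x = 0 \<longrightarrow> x = \<bottom>\<^bsub>L\<^esub>)"

definition sigma_generated_by :: "('a, 'm) gorder_scheme \<Rightarrow> 'a set \<Rightarrow> bool" where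
  "sigma_generated_by L G \<longleftrightarrow>
    G \<subseteq> carrier L \<and>
    (\<forall>S. G \<subseteq> S \<and> S \<subseteq> carrier L \<and> \<bottom>\<^bsub>L\<^esub> \<in> S \<and> \<top>\<^bsub>L\<^esub> \<in> S \<and>
      (\<forall>x\<in>S. complement L x \<in> S) \<and>
      (\<forall>A. A \<subseteq> S \<and> countable A \<longrightarrow> \<Squnion>\<^bsub>L\<^esub> A \<in> S)
      \<longrightarrow> S = carrier L)"

text \<open>
  Existence is stated with \<open>'b = (nat \<Rightarrow> 'a) set\<close>: HOL cannot quantify over types, and
  this one has room for equivalence classes of Cauchy sequences in \<open>B\<close> with respect to the
  pseudometric given by the \<open>\<mu>\<^sub>0\<close>-value of the symmetric difference.
\<close>

definition reduced_completion ::
    "('a, 'm) gorder_scheme \<Rightarrow> ('a \<Rightarrow> ennreal) \<Rightarrow>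
      ('a \<Rightarrow> 'b) \<Rightarrow> ('b, 'n) gorder_scheme \<Rightarrow> ('b \<Rightarrow> ennreal) \<Rightarrow> bool" where
  "reduced_completion B \<mu>\<^sub>0 \<beta> C \<mu> \<longleftrightarrow>
    abstract_sigma_algebra C \<and> abstract_measure C \<mu> \<and> reduced C \<mu> \<and>
    boolean_hom B C \<beta> \<and>
    sigma_generated_by C (\<beta> ` carrier B) \<and>
    (\<forall>b\<in>carrier B. \<mu> (\<beta> b) = \<mu>\<^sub>0 b)"

end

theory Submission
  imports Defs "HOL-Analysis.Caratheodory"
begin

text \<open>
  Existence. Represent \<open>B\<close> by clopen sets of its Stone space (\<open>stone\<close>). Because that space is
  compact, a decreasing sequence of clopen sets with empty intersection is eventually empty, so an
  additive function on \<open>B\<close> satisfies the hypothesis of Caratheodory's theorem for free and extends to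
  a measure on the \<open>\<sigma>\<close>-algebra generated by the clopen sets (\<open>stone_measure_exists\<close>). Dividing
  this \<open>\<sigma>\<close>-algebra by the ideal of null sets gives the completion. The class of a measurable set is
  coded by the set of sequences in \<open>B\<close> that converge to it in measure; this is a faithful code for the
  class because \<open>B\<close> is dense (\<open>stone_dense\<close>).

  Uniqueness. The measure of the symmetric difference is a pseudometric on every algebra considered.
  Given two extensions \<open>C1\<close> and \<open>C2\<close> of \<open>B\<close>, call \<open>x\<close> in \<open>C1\<close> and \<open>y\<close> in
  \<open>C2\<close> close if for each \<open>\<epsilon> > 0\<close> one element of \<open>B\<close> is simultaneously within
  \<open>\<epsilon>\<close> of \<open>x\<close> and of \<open>y\<close>. The elements of \<open>C1\<close> that are close to something form
  a \<open>\<sigma>\<close>-subalgebra containing the image of \<open>B\<close>, hence everything (\<open>close_total\<close>);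
  and closeness preserves the measure of differences (\<open>mass_difference_eq\<close>). In a reduced algebra
  \<open>x \<sqsubseteq> x'\<close> says exactly that the difference of \<open>x\<close> and \<open>x'\<close> has measure zero, so
  between reduced algebras closeness is the graph of an order isomorphism that preserves the measure.
  An order isomorphism preserves all joins, meets and complements, and a homomorphism is determined by
  its values on generators.

  The same totality result, applied to the \<open>\<sigma>\<close>-algebra of the Stone space paired with itself, is
  the density statement used for existence. For that reason extensions are treated without
  reducedness (\<open>sigma_extension\<close>), and quotients modulo an arbitrary \<open>\<sigma>\<close>-ideal of null sets
  (\<open>null_quotient\<close>), so that the zero ideal is allowed.
\<close>

section \<open>The Stone representation of a Boolean lattice\<close>

context boolean_lattice
begin

text \<open>
  As default rules these apply to every goal of the form \<open>x \<sqsubseteq> y\<close> or \<open>x = y\<close> and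
  make the classical reasoner diverge.
\<close>

declare le_cong_l [rule del] le_cong_r [rule del] weak_refl [rule del] le_antisym [rule del]

lemma complement_unique:
  assumes x: "x \<in> carrier L"
    and y: "y \<in> carrier L" "x \<sqinter> y = \<bottom>" "x \<squnion> y = \<top>"
    and z: "z \<in> carrier L" "x \<sqinter> z = \<bottom>" "x \<squnion> z = \<top>"
  shows "y = z"
proof -
  have le: "u \<sqsubseteq> v"
    if u: "u \<in> carrier L" "x \<sqinter> u = \<bottom>" and v: "v \<in> carrier L" "x \<squnion> v = \<top>" for u v
  proof -
    have "u = u \<sqinter> (x \<squnion> v)"
      using u v x by (metis le_iff_join top_closed top_higher)
    also have "\<dots> = (u \<sqinter> x) \<squnion> (u \<sqinter> v)"
      using u v x by (intro meet_join_distrib)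
    also have "\<dots> = \<bottom> \<squnion> (u \<sqinter> v)"
      using u by (simp add: meet_comm)
    also have "\<dots> = u \<sqinter> v"
      using u v by (metis bottom_closed bottom_lower le_iff_meet meet_closed)
    finally show ?thesis
      using u v le_iff_join by blast
  qed
  show ?thesis
    using le[of y z] le[of z y] y z by (intro le_antisym)
qed

lemma complement:
  assumes "x \<in> carrier L"
  shows complement_closed [simp]: "complement L x \<in> carrier L"
    and meet_complement: "x \<sqinter> complement L x = \<bottom>"
    and join_complement: "x \<squnion> complement L x = \<top>"
proof -
  let ?P = "\<lambda>y. y \<in> carrier L \<and> x \<sqinter> y = \<bottom> \<and> x \<squnion> y = \<top>"
  have "\<exists>!y. ?P y"
    using complement_exists[OF assms] complement_unique[OF assms] by blast
  then have "?P (complement L x)"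
    unfolding complement_def by (rule theI')
  then show "complement L x \<in> carrier L" "x \<sqinter> complement L x = \<bottom>" "x \<squnion> complement L x = \<top>"
    by auto
qed

lemma complement_eqI:
  assumes "x \<in> carrier L" "y \<in> carrier L" "x \<sqinter> y = \<bottom>" "x \<squnion> y = \<top>"
  shows "complement L x = y"
  using complement_unique[OF assms(1) complement[OF assms(1)] assms(2-4)] .

end

definition proper_filters :: "('a, 'm) gorder_scheme \<Rightarrow> 'a set set" where
  "proper_filters L = {F. F \<noteq> {} \<and> F \<subseteq> carrier L \<and> \<bottom>\<^bsub>L\<^esub> \<notin> F \<and>
    (\<forall>x\<in>F. \<forall>y\<in>F. x \<sqinter>\<^bsub>L\<^esub> y \<in> F) \<and> (\<forall>x\<in>F. \<forall>y\<in>carrier L. x \<sqsubseteq>\<^bsub>L\<^esub> y \<longrightarrow> y \<in> F)}"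

definition ultrafilters :: "('a, 'm) gorder_scheme \<Rightarrow> 'a set set" where
  "ultrafilters L =
    {U \<in> proper_filters L. \<forall>x\<in>carrier L. x \<in> U \<or> complement L x \<in> U}"

definition stone :: "('a, 'm) gorder_scheme \<Rightarrow> 'a \<Rightarrow> 'a set set" where
  "stone L x = {U \<in> ultrafilters L. x \<in> U}"

context boolean_lattice
begin

lemma proper_filter_meet:
  "F \<in> proper_filters L \<Longrightarrow> x \<in> F \<Longrightarrow> y \<in> F \<Longrightarrow> x \<sqinter> y \<in> F"
  by (simp add: proper_filters_def)

lemma proper_filter_up:
  "F \<in> proper_filters L \<Longrightarrow> x \<in> F \<Longrightarrow> y \<in> carrier L \<Longrightarrow> x \<sqsubseteq> y \<Longrightarrow> y \<in> F"
  by (auto simp: proper_filters_def)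

lemma proper_filter_closed:
  "F \<in> proper_filters L \<Longrightarrow> x \<in> F \<Longrightarrow> x \<in> carrier L"
  by (auto simp: proper_filters_def)

lemma proper_filter_bottom: "F \<in> proper_filters L \<Longrightarrow> \<bottom> \<notin> F"
  by (auto simp: proper_filters_def)

text \<open>
  If no element of \<open>F\<close> were disjoint from \<open>x\<close>, then \<open>F\<close> and \<open>x\<close> together would generate a proper filter
  strictly larger than \<open>F\<close>.
\<close>

lemma maximal_filter_meets_bottom:
  assumes F: "F \<in> proper_filters L"
    and maximal: "\<And>G. G \<in> proper_filters L \<Longrightarrow> F \<subseteq> G \<Longrightarrow> G = F"
    and x: "x \<in> carrier L" "x \<notin> F"
  shows "\<exists>f\<in>F. f \<sqinter> x = \<bottom>"
proof (rule ccontr)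
  assume nb: "\<not> ?thesis"
  define G where "G = {z \<in> carrier L. \<exists>f\<in>F. f \<sqinter> x \<sqsubseteq> z}"
  have FG: "F \<subseteq> G"
    using F x unfolding G_def by (auto dest: proper_filter_closed intro!: bexI meet_left)
  obtain f where f: "f \<in> F"
    using F by (auto simp: proper_filters_def)
  have fc: "f \<in> carrier L" by (rule proper_filter_closed[OF F f])
  have "x \<in> G"
    using f fc x meet_right unfolding G_def by blast
  moreover have "G \<in> proper_filters L"
    unfolding proper_filters_def
  proof (intro CollectI conjI ballI impI)
    show "G \<noteq> {}" "G \<subseteq> carrier L"
      using \<open>x \<in> G\<close> by (auto simp: G_def)
    show "\<bottom> \<notin> G"
    proof
      assume "\<bottom> \<in> G"
      then obtain g where g: "g \<in> F" "g \<sqinter> x \<sqsubseteq> \<bottom>" by (auto simp: G_def)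
      then have "g \<sqinter> x = \<bottom>"
        using x proper_filter_closed[OF F g(1)] by (intro le_antisym) auto
      with nb g show False by blast
    qed
  next
    fix u v assume "u \<in> G" "v \<in> G"
    then obtain f g where fg: "f \<in> F" "g \<in> F" "f \<sqinter> x \<sqsubseteq> u" "g \<sqinter> x \<sqsubseteq> v"
      and uv: "u \<in> carrier L" "v \<in> carrier L" by (auto simp: G_def)
    have c: "f \<in> carrier L" "g \<in> carrier L" using fg F proper_filter_closed by auto
    let ?h = "(f \<sqinter> g) \<sqinter> x"
    have h: "?h \<in> carrier L" "f \<sqinter> x \<in> carrier L" "g \<sqinter> x \<in> carrier L" using c x by auto
    have "?h \<sqsubseteq> f \<sqinter> g" "?h \<sqsubseteq> x" "f \<sqinter> g \<sqsubseteq> f" "f \<sqinter> g \<sqsubseteq> g"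
      using c x by (auto intro: meet_left meet_right)
    then have "?h \<sqsubseteq> f" "?h \<sqsubseteq> g" "?h \<sqsubseteq> x"
      using c x h le_trans by (meson meet_closed)+
    then have "?h \<sqsubseteq> f \<sqinter> x" "?h \<sqsubseteq> g \<sqinter> x"
      using c x h by (auto intro!: meet_le)
    then have "?h \<sqsubseteq> u \<sqinter> v"
      using fg uv h by (meson le_trans meet_le)
    then show "u \<sqinter> v \<in> G"
      using proper_filter_meet[OF F fg(1,2)] uv by (auto simp: G_def)
  next
    fix u v assume "u \<in> G" "v \<in> carrier L" "u \<sqsubseteq> v"
    then obtain f where "f \<in> F" "f \<sqinter> x \<sqsubseteq> u" "u \<in> carrier L" "f \<in> carrier L"
      using proper_filter_closed[OF F] by (auto simp: G_def)
    with \<open>v \<in> carrier L\<close> \<open>u \<sqsubseteq> v\<close> x have "f \<sqinter> x \<sqsubseteq> v"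
      by (intro le_trans[of "f \<sqinter> x" u v]) auto
    with \<open>f \<in> F\<close> \<open>v \<in> carrier L\<close> show "v \<in> G"
      by (auto simp: G_def)
  qed
  ultimately show False
    using maximal[OF _ FG] x by auto
qed

text \<open>
  A maximal proper filter that misses both \<open>x\<close> and its complement contains some \<open>f\<close> disjoint
  from \<open>x\<close> and some \<open>g\<close> disjoint from the complement, so \<open>f \<sqinter> g\<close> lies in the filter
  and equals \<open>\<bottom>\<close>.
\<close>

lemma proper_filter_extends:
  assumes F: "F \<in> proper_filters L"
  obtains U where "U \<in> ultrafilters L" "F \<subseteq> U"
proof -
  let ?A = "{G \<in> proper_filters L. F \<subseteq> G}"
  have "\<exists>M\<in>?A. \<forall>X\<in>?A. M \<subseteq> X \<longrightarrow> X = M"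
  proof (rule subset_Zorn_nonempty)
    show "?A \<noteq> {}" using F by blast
    fix \<C> assume ne: "\<C> \<noteq> {}" and ch: "subset.chain ?A \<C>"
    then have sub: "\<C> \<subseteq> ?A" and tot: "\<And>X Y. X \<in> \<C> \<Longrightarrow> Y \<in> \<C> \<Longrightarrow> X \<subseteq> Y \<or> Y \<subseteq> X"
      by (auto simp: subset_chain_def)
    have "\<Union>\<C> \<in> proper_filters L"
      unfolding proper_filters_def
    proof (intro CollectI conjI ballI impI)
      fix x y assume "x \<in> \<Union>\<C>" "y \<in> \<Union>\<C>"
      then obtain X where "X \<in> \<C>" "x \<in> X" "y \<in> X" using tot by blast
      then show "x \<sqinter> y \<in> \<Union>\<C>" using sub proper_filter_meet by blast
    next
      show "\<Union>\<C> \<noteq> {}"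
        using sub ne by (fastforce simp: proper_filters_def)
      show "\<Union>\<C> \<subseteq> carrier L" "\<bottom> \<notin> \<Union>\<C>"
        using sub proper_filter_closed proper_filter_bottom by blast+
    next
      fix x y assume "x \<in> \<Union>\<C>" "y \<in> carrier L" "x \<sqsubseteq> y"
      then show "y \<in> \<Union>\<C>" using sub proper_filter_up by blast
    qed
    then show "\<Union>\<C> \<in> ?A" using ne sub by blast
  qed
  then obtain U where U: "U \<in> proper_filters L" "F \<subseteq> U"
    and max: "\<And>G. G \<in> proper_filters L \<Longrightarrow> U \<subseteq> G \<Longrightarrow> G = U"
    by auto
  have "x \<in> U \<or> complement L x \<in> U" if x: "x \<in> carrier L" for x
  proof (rule ccontr)
    assume "\<not> ?thesis"
    then obtain f g where fg: "f \<in> U" "g \<in> U" "f \<sqinter> x = \<bottom>" "g \<sqinter> complement L x = \<bottom>"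
      using maximal_filter_meets_bottom[OF U(1) max] x complement_closed by meson
    define h where "h = f \<sqinter> g"
    have c: "f \<in> carrier L" "g \<in> carrier L" using fg U proper_filter_closed by auto
    have h: "h \<in> U" "h \<in> carrier L" "h \<sqsubseteq> f" "h \<sqsubseteq> g"
      using proper_filter_meet[OF U(1) fg(1,2)] c
      by (auto simp: h_def intro: meet_left meet_right)
    have "h \<sqinter> y \<sqsubseteq> k \<sqinter> y" if "y \<in> carrier L" "k \<in> carrier L" "h \<sqsubseteq> k" for y k
      using that h by (meson le_trans meet_closed meet_le meet_left meet_right)
    then have "h \<sqinter> x \<sqsubseteq> \<bottom>" "h \<sqinter> complement L x \<sqsubseteq> \<bottom>"
      using fg h c x complement_closed by metis+
    then have "(h \<sqinter> x) \<squnion> (h \<sqinter> complement L x) \<sqsubseteq> \<bottom>"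
      using h x by (intro join_le) auto
    then have "h \<sqinter> \<top> \<sqsubseteq> \<bottom>"
      using h x by (simp add: meet_join_distrib[symmetric] join_complement)
    moreover have "h \<sqinter> \<top> = h"
      using h le_iff_join[of h \<top>] by simp
    ultimately have "h = \<bottom>"
      using h by (intro le_antisym) auto
    with h(1) U(1) proper_filter_bottom show False by blast
  qed
  with U that show ?thesis by (auto simp: ultrafilters_def)
qed

lemma ultrafilter_complement_iff:
  assumes U: "U \<in> ultrafilters L" and x: "x \<in> carrier L"
  shows "complement L x \<in> U \<longleftrightarrow> x \<notin> U"
proof -
  have "\<not> (x \<in> U \<and> complement L x \<in> U)"
    using U x proper_filter_meet[of U x "complement L x"] proper_filter_bottom[of U]
    by (auto simp: meet_complement ultrafilters_def)
  with U x show ?thesis by (auto simp: ultrafilters_def)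
qed

lemma ultrafilter_up:
  assumes "U \<in> ultrafilters L" "x \<in> U" "y \<in> carrier L" "x \<sqsubseteq> y" shows "y \<in> U"
  using assms proper_filter_up by (auto simp: ultrafilters_def)

lemma ultrafilter_meet_iff:
  assumes U: "U \<in> ultrafilters L" and x: "x \<in> carrier L" and y: "y \<in> carrier L"
  shows "x \<sqinter> y \<in> U \<longleftrightarrow> x \<in> U \<and> y \<in> U"
  using U proper_filter_meet[of U x y] ultrafilter_up[OF U _ x meet_left[OF x y]]
    ultrafilter_up[OF U _ y meet_right[OF x y]]
  by (auto simp: ultrafilters_def)

lemma ultrafilter_join_iff:
  assumes U: "U \<in> ultrafilters L" and x: "x \<in> carrier L" and y: "y \<in> carrier L"
  shows "x \<squnion> y \<in> U \<longleftrightarrow> x \<in> U \<or> y \<in> U"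
proof
  assume "x \<in> U \<or> y \<in> U"
  then show "x \<squnion> y \<in> U"
    using ultrafilter_up[OF U _ _ join_left[OF x y]] ultrafilter_up[OF U _ _ join_right[OF x y]]
      x y by auto
next
  assume j: "x \<squnion> y \<in> U"
  show "x \<in> U \<or> y \<in> U"
  proof (rule ccontr)
    assume "\<not> ?thesis"
    then have nx: "complement L x \<in> U" and "y \<notin> U"
      using ultrafilter_complement_iff[OF U x] by auto
    have "complement L x \<sqinter> (x \<squnion> y) = \<bottom> \<squnion> (complement L x \<sqinter> y)"
      using x y by (simp add: meet_join_distrib meet_comm[of L "complement L x" x] meet_complement)
    also have "\<dots> = complement L x \<sqinter> y"
      using x y le_iff_meet[of \<bottom> "complement L x \<sqinter> y"] by simp
    finally have "complement L x \<sqinter> y \<in> U"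
      using nx j ultrafilter_meet_iff[OF U, of "complement L x" "x \<squnion> y"] x y by simp
    then show False
      using ultrafilter_meet_iff[OF U, of "complement L x" y] x y \<open>y \<notin> U\<close> by simp
  qed
qed

text \<open>
  With these equations as rewrite rules, an identity or inequality between Boolean terms becomes one
  between sets, which the automation decides (\<open>stone_subset_iff\<close>, \<open>stone_eq_iff\<close>).
\<close>

lemma stone_meet [simp]:
  "x \<in> carrier L \<Longrightarrow> y \<in> carrier L \<Longrightarrow> stone L (x \<sqinter> y) = stone L x \<inter> stone L y"
  by (auto simp: stone_def ultrafilter_meet_iff)

lemma stone_join [simp]:
  "x \<in> carrier L \<Longrightarrow> y \<in> carrier L \<Longrightarrow> stone L (x \<squnion> y) = stone L x \<union> stone L y"
  by (auto simp: stone_def ultrafilter_join_iff)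

lemma stone_complement [simp]:
  "x \<in> carrier L \<Longrightarrow> stone L (complement L x) = ultrafilters L - stone L x"
  by (auto simp: stone_def ultrafilter_complement_iff)

lemma stone_bottom [simp]: "stone L \<bottom> = {}"
  by (auto simp: stone_def ultrafilters_def proper_filters_def)

lemma stone_top [simp]: "stone L \<top> = ultrafilters L"
proof -
  have "\<top> \<in> U" if "U \<in> ultrafilters L" for U
    using that ultrafilter_up[OF that, of _ \<top>]
    by (auto simp: ultrafilters_def proper_filters_def)
  then show ?thesis by (auto simp: stone_def)
qed

lemma stone_subset: "stone L x \<subseteq> ultrafilters L"
  by (auto simp: stone_def)

text \<open>
  Compactness of the Stone space: if no \<open>a n\<close> were \<open>\<bottom>\<close>, then the elements above some \<open>a n\<close> would form
  a proper filter, and an ultrafilter containing it would lie in every \<open>stone L (a n)\<close>.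
\<close>

lemma stone_decreasing_empty:
  assumes a: "\<And>n :: nat. a n \<in> carrier L" and dec: "\<And>n. a (Suc n) \<sqsubseteq> a n"
    and empty: "(\<Inter>n. stone L (a n)) = {}"
  shows "\<exists>n. a n = \<bottom>"
proof (rule ccontr)
  assume nb: "\<not> ?thesis"
  have dec': "a n \<sqsubseteq> a m" if "m \<le> n" for m n
    using that
  proof (induction n rule: dec_induct)
    case (step n)
    then show ?case using le_trans[of "a (Suc n)" "a n" "a m"] a dec by blast
  qed (use a in simp)
  define F where "F = {z \<in> carrier L. \<exists>n. a n \<sqsubseteq> z}"
  have "F \<in> proper_filters L"
    unfolding proper_filters_def
  proof (intro CollectI conjI ballI impI)
    show "F \<noteq> {}" "F \<subseteq> carrier L" using a unfolding F_def by auto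
    show "\<bottom> \<notin> F"
      using a nb le_antisym[of _ \<bottom>] by (auto simp: F_def)
  next
    fix x y assume "x \<in> F" "y \<in> F"
    then obtain m n where mn: "a m \<sqsubseteq> x" "a n \<sqsubseteq> y" and c: "x \<in> carrier L" "y \<in> carrier L"
      by (auto simp: F_def)
    have "a (max m n) \<sqsubseteq> x" "a (max m n) \<sqsubseteq> y"
      using mn c a dec'[of m "max m n"] dec'[of n "max m n"] le_trans by (metis max.cobounded1 max.cobounded2)+
    then show "x \<sqinter> y \<in> F"
      using c meet_le[of "a (max m n)" x y] a by (auto simp: F_def)
  next
    fix x y assume "x \<in> F" "y \<in> carrier L" "x \<sqsubseteq> y"
    then obtain n where "a n \<sqsubseteq> x" "x \<in> carrier L" by (auto simp: F_def)
    with \<open>y \<in> carrier L\<close> \<open>x \<sqsubseteq> y\<close> a have "a n \<sqsubseteq> y"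
      by (intro le_trans[of "a n" x y]) auto
    with \<open>y \<in> carrier L\<close> show "y \<in> F" by (auto simp: F_def)
  qed
  then obtain U where U: "U \<in> ultrafilters L" "F \<subseteq> U"
    by (rule proper_filter_extends)
  have "a n \<in> F" for n
    using a[of n] le_refl[OF a[of n]] by (auto simp: F_def)
  with U have "U \<in> (\<Inter>n. stone L (a n))"
    by (auto simp: stone_def)
  with empty show False by blast
qed

lemma stone_empty_iff:
  assumes "x \<in> carrier L" shows "stone L x = {} \<longleftrightarrow> x = \<bottom>"
  using stone_decreasing_empty[of "\<lambda>_. x"] assms by auto

lemma stone_subset_iff:
  assumes x: "x \<in> carrier L" and y: "y \<in> carrier L"
  shows "stone L x \<subseteq> stone L y \<longleftrightarrow> x \<sqsubseteq> y"
proof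
  assume "x \<sqsubseteq> y"
  then show "stone L x \<subseteq> stone L y"
    using y ultrafilter_up by (auto simp: stone_def)
next
  assume sub: "stone L x \<subseteq> stone L y"
  then have "stone L (x \<sqinter> complement L y) = {}"
    using x y by auto
  then have b: "x \<sqinter> complement L y = \<bottom>"
    using x y by (subst (asm) stone_empty_iff) auto
  have "x = x \<sqinter> (y \<squnion> complement L y)"
    using x y le_iff_join[of x \<top>] by (simp add: join_complement)
  also have "\<dots> = (x \<sqinter> y) \<squnion> \<bottom>"
    using x y b by (simp add: meet_join_distrib)
  also have "\<dots> = x \<sqinter> y"
    using x y le_iff_meet[of \<bottom> "x \<sqinter> y"] by (simp add: join_comm[of L "x \<sqinter> y"])
  finally show "x \<sqsubseteq> y"
    using x y le_iff_join by blast
qed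

lemma stone_eq_iff:
  assumes "x \<in> carrier L" "y \<in> carrier L"
  shows "stone L x = stone L y \<longleftrightarrow> x = y"
  using assms by (metis le_antisym stone_subset_iff subset_refl)

end

section \<open>Finite measures on abstract sigma-algebras\<close>

context abstract_sigma_algebra
begin

lemma sup_lub:
  assumes "A \<subseteq> carrier L" "countable A"
  shows "least L (\<Squnion>A) (Upper L A)"
  using countable_sup_exists[OF assms] unfolding Lattice.sup_def by (rule someI_ex)

lemma sup_eqI:
  assumes "A \<subseteq> carrier L" "countable A" "least L s (Upper L A)"
  shows "\<Squnion>A = s"
  using sup_lub[OF assms(1,2)] assms(3) by (rule least_unique)

lemma sup_closed [simp]:
  "A \<subseteq> carrier L \<Longrightarrow> countable A \<Longrightarrow> \<Squnion>A \<in> carrier L"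
  using sup_lub by blast

lemma sup_upper:
  "A \<subseteq> carrier L \<Longrightarrow> countable A \<Longrightarrow> x \<in> A \<Longrightarrow> x \<sqsubseteq> \<Squnion>A"
  using least_Upper_above[OF sup_lub] by blast

lemma sup_below:
  "A \<subseteq> carrier L \<Longrightarrow> countable A \<Longrightarrow> u \<in> carrier L \<Longrightarrow> (\<And>x. x \<in> A \<Longrightarrow> x \<sqsubseteq> u) \<Longrightarrow> \<Squnion>A \<sqsubseteq> u"
  using least_le[OF sup_lub] Upper_memI by metis

lemma sup_empty: "\<Squnion>{} = \<bottom>"
  using bottom_least by (intro sup_eqI) auto

end

definition difference :: "('a, 'm) gorder_scheme \<Rightarrow> 'a \<Rightarrow> 'a \<Rightarrow> 'a" where
  "difference L x y = x \<sqinter>\<^bsub>L\<^esub> complement L y"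

definition symm_diff :: "('a, 'm) gorder_scheme \<Rightarrow> 'a \<Rightarrow> 'a \<Rightarrow> 'a" where
  "symm_diff L x y = difference L x y \<squnion>\<^bsub>L\<^esub> difference L y x"

context boolean_lattice
begin

lemma difference_closed [simp]:
  "x \<in> carrier L \<Longrightarrow> y \<in> carrier L \<Longrightarrow> difference L x y \<in> carrier L"
  by (simp add: difference_def)

lemma symm_diff_closed [simp]:
  "x \<in> carrier L \<Longrightarrow> y \<in> carrier L \<Longrightarrow> symm_diff L x y \<in> carrier L"
  by (simp add: symm_diff_def)

lemma stone_difference [simp]:
  "x \<in> carrier L \<Longrightarrow> y \<in> carrier L \<Longrightarrow> stone L (difference L x y) = stone L x - stone L y"
  using stone_subset[of x] by (auto simp: difference_def)

lemma stone_symm_diff [simp]: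
  "x \<in> carrier L \<Longrightarrow> y \<in> carrier L \<Longrightarrow>
    stone L (symm_diff L x y) = (stone L x - stone L y) \<union> (stone L y - stone L x)"
  by (simp add: symm_diff_def)

end

locale finite_content = boolean_lattice +
  fixes \<mu> :: "'a \<Rightarrow> ennreal"
  assumes additive: "additive_on L \<mu>"
    and finite_top: "\<mu> \<top> < \<infinity>"
begin

lemma content_bottom: "\<mu> \<bottom> = 0"
  using additive by (simp add: additive_on_def)

text \<open>
  The hypotheses are phrased in the Stone representation so that they can be discharged by set
  reasoning.
\<close>

lemma content_disjoint:
  assumes "x \<in> carrier L" "y \<in> carrier L" "z \<in> carrier L"
    and "stone L x \<inter> stone L y = {}" "stone L z = stone L x \<union> stone L y"
  shows "\<mu> z = \<mu> x + \<mu> y"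
proof -
  have "x \<sqinter> y = \<bottom>" "z = x \<squnion> y"
    using assms by (auto simp flip: stone_empty_iff stone_eq_iff)
  with additive assms show ?thesis by (simp add: additive_on_def)
qed

lemma content_mono:
  assumes "x \<in> carrier L" "y \<in> carrier L" "stone L x \<subseteq> stone L y"
  shows "\<mu> x \<le> \<mu> y"
proof -
  have "\<mu> y = \<mu> x + \<mu> (difference L y x)"
    using assms by (intro content_disjoint) auto
  then show ?thesis by simp
qed

lemma content_subadditive:
  assumes "x \<in> carrier L" "y \<in> carrier L" "z \<in> carrier L"
    and "stone L x \<subseteq> stone L y \<union> stone L z"
  shows "\<mu> x \<le> \<mu> y + \<mu> z"
proof -
  have "\<mu> x \<le> \<mu> (y \<squnion> difference L z y)"
    using assms by (intro content_mono) auto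
  also have "\<dots> = \<mu> y + \<mu> (difference L z y)"
    using assms by (intro content_disjoint) auto
  also have "\<dots> \<le> \<mu> y + \<mu> z"
    using assms by (intro add_left_mono content_mono) auto
  finally show ?thesis .
qed

lemma content_finite:
  assumes "x \<in> carrier L" shows "\<mu> x < \<infinity>"
  using content_mono[OF assms top_closed] finite_top stone_subset[of x]
  by (simp add: order_le_less_trans)

text \<open>
  Real values turn the \<open>\<epsilon>\<close>-estimates below into linear arithmetic.
\<close>

definition mass :: "'a \<Rightarrow> real" where "mass x = enn2real (\<mu> x)"

abbreviation pdist :: "'a \<Rightarrow> 'a \<Rightarrow> real" where "pdist x y \<equiv> mass (symm_diff L x y)"

lemma ennreal_mass: "x \<in> carrier L \<Longrightarrow> ennreal (mass x) = \<mu> x"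
  using content_finite by (simp add: mass_def)

lemma mass_nonneg [simp]: "0 \<le> mass x"
  by (simp add: mass_def)

lemma mass_mono:
  "x \<in> carrier L \<Longrightarrow> y \<in> carrier L \<Longrightarrow> stone L x \<subseteq> stone L y \<Longrightarrow> mass x \<le> mass y"
  using content_mono[of x y] content_finite[of y] by (simp add: mass_def enn2real_mono)

lemma mass_subadditive:
  assumes "x \<in> carrier L" "y \<in> carrier L" "z \<in> carrier L" "stone L x \<subseteq> stone L y \<union> stone L z"
  shows "mass x \<le> mass y + mass z"
  using content_subadditive[OF assms] assms(1-3)
  by (simp flip: ennreal_mass ennreal_plus)

lemma pdist_triangle:
  assumes "x \<in> carrier L" "y \<in> carrier L" "z \<in> carrier L"
  shows "pdist x z \<le> pdist x y + pdist y z"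
  using assms by (intro mass_subadditive) auto

lemma pdist_join:
  assumes "x \<in> carrier L" "y \<in> carrier L" "x' \<in> carrier L" "y' \<in> carrier L"
  shows "pdist (x \<squnion> y) (x' \<squnion> y') \<le> pdist x x' + pdist y y'"
  using assms by (intro mass_subadditive) auto

lemma pdist_complement:
  assumes "x \<in> carrier L" "y \<in> carrier L"
  shows "pdist (complement L x) (complement L y) \<le> pdist x y"
  using assms stone_subset[of x] stone_subset[of y] by (intro mass_mono) auto

lemma pdist_self: "x \<in> carrier L \<Longrightarrow> pdist x x = 0"
  using content_bottom stone_empty_iff[of "symm_diff L x x"] by (simp add: mass_def)

text \<open>
  The mass of a difference is 1-Lipschitz in each argument: a point of \<open>x\<close> outside \<open>y\<close> lies
  in \<open>x'\<close> outside \<open>y'\<close> unless \<open>x\<close> and \<open>x'\<close>, or \<open>y\<close> and \<open>y'\<close>, differ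
  there.
\<close>

lemma mass_difference_perturb:
  assumes "x \<in> carrier L" "y \<in> carrier L" "x' \<in> carrier L" "y' \<in> carrier L"
  shows "mass (difference L x y) \<le> pdist x' x + mass (difference L x' y') + pdist y' y"
proof -
  have "mass (difference L x y) \<le> mass (symm_diff L x' x) + mass (difference L x' y' \<squnion> symm_diff L y' y)"
    using assms by (intro mass_subadditive) auto
  also have "mass (difference L x' y' \<squnion> symm_diff L y' y) \<le> mass (difference L x' y') + mass (symm_diff L y' y)"
    using assms by (intro mass_subadditive) auto
  finally show ?thesis by simp
qed

end

primrec partial_join :: "('a, 'm) gorder_scheme \<Rightarrow> (nat \<Rightarrow> 'a) \<Rightarrow> nat \<Rightarrow> 'a" where
  "partial_join L a 0 = \<bottom>\<^bsub>L\<^esub>"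
| "partial_join L a (Suc n) = partial_join L a n \<squnion>\<^bsub>L\<^esub> a n"

locale finite_measure_algebra = abstract_sigma_algebra +
  fixes \<mu> :: "'a \<Rightarrow> ennreal"
  assumes measure: "abstract_measure L \<mu>"
    and finite_measure_top: "\<mu> \<top> < \<infinity>"
begin

lemma measure_additive: "additive_on L \<mu>"
  unfolding additive_on_def
proof (intro conjI ballI impI)
  show zero: "\<mu> \<bottom> = 0"
    using measure by (simp add: abstract_measure_def)
  fix x y assume xy: "x \<in> carrier L" "y \<in> carrier L" "x \<sqinter> y = \<bottom>"
  \<comment> \<open>a binary join as a countable one, padded with \<open>\<bottom>\<close>\<close>
  define a where "a n = (if n = 0 then x else if n = 1 then y else \<bottom>)" for n :: nat
  have ra: "range a = {x, y, \<bottom>}"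
    unfolding a_def by (auto simp: image_iff split: if_splits intro: exI[of _ "2::nat"])
  have disj: "a i \<sqinter> a j = \<bottom>" if "i \<noteq> j" for i j
    using that xy by (auto simp: a_def simp flip: stone_empty_iff)
  have "\<Squnion>(range a) = x \<squnion> y"
    using xy unfolding ra
    by (intro le_antisym sup_below join_le sup_upper sup_closed join_closed)
      (auto intro: join_left join_right)
  moreover have "\<mu> (\<Squnion>(range a)) = (\<Sum>i. \<mu> (a i))"
  proof -
    have "range a \<subseteq> carrier L" using xy ra by auto
    with measure disj show ?thesis unfolding abstract_measure_def by blast
  qed
  moreover have "(\<Sum>i. \<mu> (a i)) = (\<Sum>i\<in>{0, 1}. \<mu> (a i))"
    by (rule suminf_finite) (auto simp: a_def zero)
  ultimately show "\<mu> (x \<squnion> y) = \<mu> x + \<mu> y"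
    by (simp add: a_def)
qed

sublocale finite_content L \<mu>
  using measure_additive finite_measure_top by unfold_locales

lemma partial_join_closed [simp]:
  assumes "\<And>n. a n \<in> carrier L" shows "partial_join L a n \<in> carrier L"
  by (induction n) (use assms in auto)

lemma stone_partial_join:
  assumes "\<And>n. a n \<in> carrier L"
  shows "stone L (partial_join L a n) = (\<Union>i<n. stone L (a i))"
  by (induction n) (use assms in \<open>auto simp: less_Suc_eq\<close>)

text \<open>
  The Stone map does not preserve infinite joins, so countable additivity has to be used inside the
  algebra: the differences \<open>e n\<close> of \<open>a n\<close> and the join of its predecessors are disjoint and
  have the same join as the \<open>a n\<close>, and the measure of a partial join is a partial sum of the series
  of the measures of the \<open>e n\<close>.
\<close>

lemma partial_join_tendsto:
  assumes a: "\<And>n. a n \<in> carrier L"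
  shows "(\<lambda>n. pdist (partial_join L a n) (\<Squnion>(range a))) \<longlonglongrightarrow> 0"
proof -
  define x where "x = \<Squnion>(range a)"
  define e where "e n = difference L (a n) (partial_join L a n)" for n
  note [simp] = a stone_partial_join[OF a] partial_join_closed[OF a]
  have e: "e n \<in> carrier L" for n by (simp add: e_def)
  have ra: "range a \<subseteq> carrier L" "countable (range a)" "range e \<subseteq> carrier L" "countable (range e)"
    using a e by auto
  have x: "x \<in> carrier L" using ra by (simp add: x_def)
  have sub: "stone L (a n) \<subseteq> stone L x" for n
    using a ra x sup_upper[of "range a" "a n"] by (subst stone_subset_iff) (auto simp: x_def)
  have eq: "\<Squnion>(range e) = x"
  proof (rule le_antisym)
    have "e n \<sqsubseteq> x" for n
      using e x sub[of n] by (auto simp: e_def simp flip: stone_subset_iff)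
    then show "\<Squnion>(range e) \<sqsubseteq> x"
      using ra x by (intro sup_below) auto
    have pe: "partial_join L a n \<sqsubseteq> \<Squnion>(range e)" for n
    proof (induction n)
      case 0
      show ?case using ra by simp
    next
      case (Suc n)
      have "e n \<sqsubseteq> \<Squnion>(range e)" using ra by (intro sup_upper) auto
      with Suc ra have "stone L (partial_join L a n) \<subseteq> stone L (\<Squnion>(range e))"
          "stone L (e n) \<subseteq> stone L (\<Squnion>(range e))"
        using e by (auto simp only: stone_subset_iff partial_join_closed[OF a] sup_closed)
      then have "stone L (partial_join L a (Suc n)) \<subseteq> stone L (\<Squnion>(range e))"
        by (simp add: e_def) blast
      then show ?case
        using ra by (subst (asm) stone_subset_iff) (auto simp del: partial_join.simps)
    qed
    have "a n \<sqsubseteq> \<Squnion>(range e)" for n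
    proof -
      have "a n \<sqsubseteq> partial_join L a (Suc n)"
        by (simp add: join_right)
      then show ?thesis
        using pe[of "Suc n"] ra by (meson a le_trans partial_join_closed sup_closed)
    qed
    then show "x \<sqsubseteq> \<Squnion>(range e)"
      unfolding x_def using ra by (intro sup_below) auto
  qed (use ra x in auto)
  have "\<mu> x = (\<Sum>i. \<mu> (e i))"
  proof -
    have "e i \<sqinter> e j = \<bottom>" if "i \<noteq> j" for i j
    proof -
      have "e i \<sqinter> e j \<in> carrier L" "stone L (e i \<sqinter> e j) = {}"
        using that e[of i] e[of j] by (auto simp: e_def) (metis lessThan_iff linorder_neqE_nat)
      then show ?thesis using stone_empty_iff by blast
    qed
    then show ?thesis
      using measure ra unfolding abstract_measure_def eq[symmetric] by blast
  qed
  moreover have "\<mu> (partial_join L a n) = (\<Sum>i<n. \<mu> (e i))" for n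
  proof (induction n)
    case (Suc n)
    have "\<mu> (partial_join L a (Suc n)) = \<mu> (partial_join L a n) + \<mu> (e n)"
      by (intro content_disjoint) (auto simp: e_def less_Suc_eq)
    with Suc show ?case by simp
  qed (simp add: content_bottom)
  ultimately have lim: "(\<lambda>n. \<mu> (partial_join L a n)) \<longlonglongrightarrow> \<mu> x"
    by (simp add: summable_LIMSEQ)
  have "mass x = mass (partial_join L a n) + pdist (partial_join L a n) x" for n
  proof -
    have "\<mu> x = \<mu> (partial_join L a n) + \<mu> (symm_diff L (partial_join L a n) x)"
      using x sub by (intro content_disjoint) auto
    then show ?thesis
      using x by (simp flip: ennreal_mass ennreal_plus)
  qed
  then have "pdist (partial_join L a n) x = mass x - mass (partial_join L a n)" for n
    by (simp add: algebra_simps)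
  moreover have "(\<lambda>n. mass (partial_join L a n)) \<longlonglongrightarrow> mass x"
    unfolding mass_def using lim content_finite[OF x] by (intro tendsto_enn2real) auto
  ultimately show ?thesis
    unfolding x_def[symmetric] by (auto intro!: tendsto_eq_intros)
qed

end

section \<open>Homomorphisms of abstract sigma-algebras\<close>

text \<open>
  \<open>f\<close> and its monotone inverse \<open>g\<close> are adjoint on both sides, so bounds can be moved across
  either map; and complements are determined by meets and joins.
\<close>

lemma order_iso_sigma_hom:
  assumes "abstract_sigma_algebra L" "abstract_sigma_algebra M"
    and f: "f \<in> carrier L \<rightarrow> carrier M" and g: "g \<in> carrier M \<rightarrow> carrier L"
    and fg: "\<And>y. y \<in> carrier M \<Longrightarrow> f (g y) = y"
    and fmono: "\<And>x y. x \<in> carrier L \<Longrightarrow> y \<in> carrier L \<Longrightarrow> x \<sqsubseteq>\<^bsub>L\<^esub> y \<Longrightarrow> f x \<sqsubseteq>\<^bsub>M\<^esub> f y"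
    and gf: "\<And>x. x \<in> carrier L \<Longrightarrow> g (f x) = x"
    and gmono: "\<And>x y. x \<in> carrier M \<Longrightarrow> y \<in> carrier M \<Longrightarrow> x \<sqsubseteq>\<^bsub>M\<^esub> y \<Longrightarrow> g x \<sqsubseteq>\<^bsub>L\<^esub> g y"
  shows "sigma_hom L M f"
proof -
  interpret L: abstract_sigma_algebra L by fact
  interpret M: abstract_sigma_algebra M by fact
  have fc: "f x \<in> carrier M" if "x \<in> carrier L" for x using f that by blast
  have gc: "g y \<in> carrier L" if "y \<in> carrier M" for y using g that by blast
  have f_le: "f x \<sqsubseteq>\<^bsub>M\<^esub> y" if "x \<in> carrier L" "y \<in> carrier M" "x \<sqsubseteq>\<^bsub>L\<^esub> g y" for x y
    using fmono[OF that(1) gc[OF that(2)] that(3)] fg that by simp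
  have f_ge: "y \<sqsubseteq>\<^bsub>M\<^esub> f x" if "x \<in> carrier L" "y \<in> carrier M" "g y \<sqsubseteq>\<^bsub>L\<^esub> x" for x y
    using fmono[OF gc[OF that(2)] that(1,3)] fg that by simp
  have g_le: "g y \<sqsubseteq>\<^bsub>L\<^esub> x" if "x \<in> carrier L" "y \<in> carrier M" "y \<sqsubseteq>\<^bsub>M\<^esub> f x" for x y
    using gmono[OF that(2) fc[OF that(1)] that(3)] gf that by simp
  have g_ge: "x \<sqsubseteq>\<^bsub>L\<^esub> g y" if "x \<in> carrier L" "y \<in> carrier M" "f x \<sqsubseteq>\<^bsub>M\<^esub> y" for x y
    using gmono[OF fc[OF that(1)] that(2,3)] gf that by simp
  have bottom: "f \<bottom>\<^bsub>L\<^esub> = \<bottom>\<^bsub>M\<^esub>"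
    by (rule M.bottom_eq) (auto intro: f_le fc gc)
  have top: "f \<top>\<^bsub>L\<^esub> = \<top>\<^bsub>M\<^esub>"
    by (rule M.top_eq) (auto intro: f_ge fc gc)
  have compl: "f (complement L x) = complement M (f x)" if x: "x \<in> carrier L" for x
  proof -
    let ?c = "complement L x"
    have c: "?c \<in> carrier L" "f x \<in> carrier M" "f ?c \<in> carrier M"
      using x fc by auto
    have "g (f x \<sqinter>\<^bsub>M\<^esub> f ?c) \<sqsubseteq>\<^bsub>L\<^esub> x \<sqinter>\<^bsub>L\<^esub> ?c"
      using x c by (intro L.meet_le g_le gc M.meet_closed M.meet_left M.meet_right)
    then have "f x \<sqinter>\<^bsub>M\<^esub> f ?c \<sqsubseteq>\<^bsub>M\<^esub> f (x \<sqinter>\<^bsub>L\<^esub> ?c)"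
      using x c by (intro f_ge) auto
    then have m: "f x \<sqinter>\<^bsub>M\<^esub> f ?c = \<bottom>\<^bsub>M\<^esub>"
      using x c bottom by (intro M.le_antisym) (auto simp: L.meet_complement)
    have "x \<squnion>\<^bsub>L\<^esub> ?c \<sqsubseteq>\<^bsub>L\<^esub> g (f x \<squnion>\<^bsub>M\<^esub> f ?c)"
      using x c by (intro L.join_le g_ge gc M.join_closed M.join_left M.join_right)
    then have "f (x \<squnion>\<^bsub>L\<^esub> ?c) \<sqsubseteq>\<^bsub>M\<^esub> f x \<squnion>\<^bsub>M\<^esub> f ?c"
      using x c by (intro f_le) auto
    then have "f x \<squnion>\<^bsub>M\<^esub> f ?c = \<top>\<^bsub>M\<^esub>"
      using x c top by (intro M.le_antisym) (auto simp: L.join_complement)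
    with m c show ?thesis by (intro M.complement_eqI[symmetric])
  qed
  have sup: "f (\<Squnion>\<^bsub>L\<^esub>A) = \<Squnion>\<^bsub>M\<^esub>(f ` A)" if A: "A \<subseteq> carrier L" "countable A" for A
  proof (rule M.sup_eqI[symmetric])
    show fA: "f ` A \<subseteq> carrier M" "countable (f ` A)" using A fc by auto
    show "least M (f (\<Squnion>\<^bsub>L\<^esub>A)) (Upper M (f ` A))"
    proof (rule least_UpperI)
      fix z assume "z \<in> f ` A"
      then obtain x where x: "x \<in> A" "z = f x" by blast
      then show "z \<sqsubseteq>\<^bsub>M\<^esub> f (\<Squnion>\<^bsub>L\<^esub>A)"
        using A by (simp add: fmono subsetD L.sup_upper)
    next
      fix y assume y: "y \<in> Upper M (f ` A)"
      then have yc: "y \<in> carrier M" using Upper_closed[of M "f ` A"] by blast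
      have "x \<sqsubseteq>\<^bsub>L\<^esub> g y" if "x \<in> A" for x
      proof (rule g_ge)
        show "x \<in> carrier L" "y \<in> carrier M" using that A yc by auto
        show "f x \<sqsubseteq>\<^bsub>M\<^esub> y" using Upper_memD[OF y _ fA(1)] that by blast
      qed
      then have "\<Squnion>\<^bsub>L\<^esub>A \<sqsubseteq>\<^bsub>L\<^esub> g y"
        by (rule L.sup_below[OF A gc[OF yc]])
      then show "f (\<Squnion>\<^bsub>L\<^esub>A) \<sqsubseteq>\<^bsub>M\<^esub> y"
        by (rule f_le[OF L.sup_closed[OF A] yc])
    qed (use A fA fc in auto)
  qed
  show ?thesis
    unfolding sigma_hom_def using f fmono bottom top compl sup by blast
qed

text \<open>
  \<open>\<bottom>\<close> is the empty join and \<open>\<top>\<close> its complement, so closure under complements and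
  countable joins accounts for both.
\<close>

lemma (in abstract_sigma_algebra) sigma_generated_induct [consumes 2, case_names generator complement sup]:
  assumes gen: "sigma_generated_by L G" and x: "x \<in> carrier L"
    and generator: "\<And>x. x \<in> G \<Longrightarrow> P x"
    and complement: "\<And>x. x \<in> carrier L \<Longrightarrow> P x \<Longrightarrow> P (complement L x)"
    and sup: "\<And>A. A \<subseteq> carrier L \<Longrightarrow> countable A \<Longrightarrow> (\<And>x. x \<in> A \<Longrightarrow> P x) \<Longrightarrow> P (\<Squnion>A)"
  shows "P x"
proof -
  let ?S = "{x \<in> carrier L. P x}"
  have bottom: "\<bottom> \<in> ?S"
    using sup[of "{}"] by (simp add: sup_empty)
  have top: "complement L \<bottom> = \<top>"
    by (rule complement_eqI) (auto simp flip: stone_eq_iff)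
  have "?S = carrier L"
  proof (rule gen[unfolded sigma_generated_by_def, THEN conjunct2, rule_format], intro conjI ballI allI impI)
    show "G \<subseteq> ?S"
      using gen generator by (auto simp: sigma_generated_by_def)
    show "?S \<subseteq> carrier L" by blast
    show "\<bottom> \<in> ?S" by (rule bottom)
    show "\<top> \<in> ?S"
      using complement[of \<bottom>] bottom by (simp add: top)
    show "complement L x \<in> ?S" if "x \<in> ?S" for x
      using that complement by simp
    show "\<Squnion>A \<in> ?S" if "A \<subseteq> ?S \<and> countable A" for A
      using that sup[of A] sup_closed[of A] by blast
  qed
  with x show ?thesis by blast
qed

lemma sigma_hom_agree_on_generators:
  assumes gen: "sigma_generated_by L G" and L: "abstract_sigma_algebra L"
    and f: "sigma_hom L M f" and g: "sigma_hom L M g"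
    and eq: "\<And>x. x \<in> G \<Longrightarrow> f x = g x"
    and x: "x \<in> carrier L"
  shows "f x = g x"
proof -
  interpret L: abstract_sigma_algebra L by fact
  show ?thesis
    using gen x
  proof (induction rule: L.sigma_generated_induct)
    case (sup A)
    then have "f ` A = g ` A" by (auto intro!: image_cong)
    with f g sup(1,2) show ?case by (simp add: sigma_hom_def)
  qed (use f g eq in \<open>simp_all add: sigma_hom_def\<close>)
qed

section \<open>Comparing two extensions of a content\<close>

text \<open>
  A reduced completion without reducedness. The \<open>\<sigma>\<close>-algebra generated by the clopen sets of the
  Stone space is one, and it is usually not reduced.
\<close>

definition sigma_extension ::
    "('a, 'm) gorder_scheme \<Rightarrow> ('a \<Rightarrow> ennreal) \<Rightarrow>
      ('a \<Rightarrow> 'b) \<Rightarrow> ('b, 'n) gorder_scheme \<Rightarrow> ('b \<Rightarrow> ennreal) \<Rightarrow> bool" where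
  "sigma_extension B \<mu>\<^sub>0 \<beta> C \<mu> \<longleftrightarrow>
    abstract_sigma_algebra C \<and> abstract_measure C \<mu> \<and> boolean_hom B C \<beta> \<and>
    sigma_generated_by C (\<beta> ` carrier B) \<and> (\<forall>b\<in>carrier B. \<mu> (\<beta> b) = \<mu>\<^sub>0 b)"

lemma reduced_completion_iff:
  "reduced_completion B \<mu>\<^sub>0 \<beta> C \<mu> \<longleftrightarrow> sigma_extension B \<mu>\<^sub>0 \<beta> C \<mu> \<and> reduced C \<mu>"
  by (auto simp: reduced_completion_def sigma_extension_def)

lemma sigma_extension_finite_measure:
  assumes "finite_content B \<mu>\<^sub>0" "sigma_extension B \<mu>\<^sub>0 \<beta> C \<mu>"
  shows "finite_measure_algebra C \<mu>"
proof -
  interpret B: finite_content B \<mu>\<^sub>0 by fact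
  interpret C: abstract_sigma_algebra C
    using assms by (simp add: sigma_extension_def)
  have "\<mu> \<top>\<^bsub>C\<^esub> = \<mu>\<^sub>0 \<top>\<^bsub>B\<^esub>"
    using assms(2) B.top_closed unfolding sigma_extension_def boolean_hom_def by metis
  then show ?thesis
    using assms(2) B.finite_top by unfold_locales (simp_all add: sigma_extension_def)
qed

context finite_content
begin

lemma pdist_sym: "pdist x y = pdist y x"
  by (simp add: symm_diff_def join_comm)

text \<open>
  Only \<open>\<bottom>\<close> has measure zero, so the measure determines the order.
\<close>

lemma reduced_le_iff:
  assumes "reduced L \<mu>" "x \<in> carrier L" "y \<in> carrier L"
  shows "x \<sqsubseteq> y \<longleftrightarrow> mass (difference L x y) = 0"
proof -
  have "x \<sqsubseteq> y \<longleftrightarrow> difference L x y = \<bottom>"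
    using assms by (auto simp flip: stone_empty_iff stone_subset_iff)
  also have "\<dots> \<longleftrightarrow> \<mu> (difference L x y) = 0"
    using assms content_bottom by (auto simp: reduced_def)
  also have "\<dots> \<longleftrightarrow> mass (difference L x y) = 0"
    using assms by (simp flip: ennreal_mass)
  finally show ?thesis .
qed

end

locale extension_pair =
  fixes B :: "('a, 'm) gorder_scheme" and \<mu>\<^sub>0 :: "'a \<Rightarrow> ennreal"
    and C1 :: "('b, 'n) gorder_scheme" and \<beta>1 :: "'a \<Rightarrow> 'b" and \<mu>1 :: "'b \<Rightarrow> ennreal"
    and C2 :: "('c, 'o) gorder_scheme" and \<beta>2 :: "'a \<Rightarrow> 'c" and \<mu>2 :: "'c \<Rightarrow> ennreal"
  assumes content: "finite_content B \<mu>\<^sub>0"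
    and ext1: "sigma_extension B \<mu>\<^sub>0 \<beta>1 C1 \<mu>1"
    and ext2: "sigma_extension B \<mu>\<^sub>0 \<beta>2 C2 \<mu>2"
begin

sublocale B: finite_content B \<mu>\<^sub>0 by (rule content)
sublocale C1: finite_measure_algebra C1 \<mu>1
  by (rule sigma_extension_finite_measure[OF content ext1])
sublocale C2: finite_measure_algebra C2 \<mu>2
  by (rule sigma_extension_finite_measure[OF content ext2])

lemma swap: "extension_pair B \<mu>\<^sub>0 C2 \<beta>2 \<mu>2 C1 \<beta>1 \<mu>1"
  using content ext2 ext1 by (rule extension_pair.intro)

lemma
  shows hom1_closed [simp]: "b \<in> carrier B \<Longrightarrow> \<beta>1 b \<in> carrier C1"
    and hom1_bottom [simp]: "\<beta>1 \<bottom>\<^bsub>B\<^esub> = \<bottom>\<^bsub>C1\<^esub>"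
    and hom1_complement [simp]:
      "b \<in> carrier B \<Longrightarrow> \<beta>1 (complement B b) = complement C1 (\<beta>1 b)"
    and hom1_join [simp]:
      "b \<in> carrier B \<Longrightarrow> b' \<in> carrier B \<Longrightarrow> \<beta>1 (b \<squnion>\<^bsub>B\<^esub> b') = \<beta>1 b \<squnion>\<^bsub>C1\<^esub> \<beta>1 b'"
    and hom1_meet:
      "b \<in> carrier B \<Longrightarrow> b' \<in> carrier B \<Longrightarrow> \<beta>1 (b \<sqinter>\<^bsub>B\<^esub> b') = \<beta>1 b \<sqinter>\<^bsub>C1\<^esub> \<beta>1 b'"
  using ext1 by (auto simp: sigma_extension_def boolean_hom_def)

lemma mass1_difference:
  assumes "b \<in> carrier B" "b' \<in> carrier B"
  shows "C1.mass (difference C1 (\<beta>1 b) (\<beta>1 b')) = B.mass (difference B b b')"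
proof -
  have "difference C1 (\<beta>1 b) (\<beta>1 b') = \<beta>1 (difference B b b')"
    using assms by (simp add: difference_def hom1_meet)
  then show ?thesis
    using assms ext1 by (simp add: C1.mass_def B.mass_def sigma_extension_def)
qed

lemmas hom2_closed [simp] = extension_pair.hom1_closed[OF swap]
  and hom2_bottom [simp] = extension_pair.hom1_bottom[OF swap]
  and hom2_complement [simp] = extension_pair.hom1_complement[OF swap]
  and hom2_join [simp] = extension_pair.hom1_join[OF swap]
  and mass2_difference = extension_pair.mass1_difference[OF swap]

text \<open>
  A single element \<open>b\<close> has to approximate \<open>x\<close> and \<open>y\<close> at once; this ties the two
  algebras together over \<open>B\<close>.
\<close>

definition close :: "'b \<Rightarrow> 'c \<Rightarrow> bool" where
  "close x y \<longleftrightarrow> (\<forall>\<epsilon>>0. \<exists>b\<in>carrier B. C1.pdist (\<beta>1 b) x < \<epsilon> \<and> C2.pdist (\<beta>2 b) y < \<epsilon>)"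

lemma close_swap: "extension_pair.close B C2 \<beta>2 \<mu>2 C1 \<beta>1 \<mu>1 y x \<longleftrightarrow> close x y"
  by (auto simp: close_def extension_pair.close_def[OF swap])

lemma close_generator: "b \<in> carrier B \<Longrightarrow> close (\<beta>1 b) (\<beta>2 b)"
  unfolding close_def by (auto simp: C1.pdist_self C2.pdist_self intro!: bexI[of _ b])

lemma close_complement:
  assumes "x \<in> carrier C1" "y \<in> carrier C2" "close x y"
  shows "close (complement C1 x) (complement C2 y)"
  unfolding close_def
proof (intro allI impI)
  fix \<epsilon> :: real assume "\<epsilon> > 0"
  with assms(3) obtain b where b: "b \<in> carrier B" "C1.pdist (\<beta>1 b) x < \<epsilon>" "C2.pdist (\<beta>2 b) y < \<epsilon>"
    unfolding close_def by blast
  with assms C1.pdist_complement[of "\<beta>1 b" x] C2.pdist_complement[of "\<beta>2 b" y]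
  show "\<exists>b\<in>carrier B. C1.pdist (\<beta>1 b) (complement C1 x) < \<epsilon> \<and> C2.pdist (\<beta>2 b) (complement C2 y) < \<epsilon>"
    by (intro bexI[of _ "complement B b"]) auto
qed

lemma close_join:
  assumes "x \<in> carrier C1" "y \<in> carrier C2" "close x y"
    and "x' \<in> carrier C1" "y' \<in> carrier C2" "close x' y'"
  shows "close (x \<squnion>\<^bsub>C1\<^esub> x') (y \<squnion>\<^bsub>C2\<^esub> y')"
  unfolding close_def
proof (intro allI impI)
  fix \<epsilon> :: real assume "\<epsilon> > 0"
  then have e: "\<epsilon> / 2 > 0" by simp
  obtain b where b: "b \<in> carrier B" "C1.pdist (\<beta>1 b) x < \<epsilon> / 2" "C2.pdist (\<beta>2 b) y < \<epsilon> / 2"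
    using assms(3) e unfolding close_def by blast
  obtain b' where b': "b' \<in> carrier B" "C1.pdist (\<beta>1 b') x' < \<epsilon> / 2" "C2.pdist (\<beta>2 b') y' < \<epsilon> / 2"
    using assms(6) e unfolding close_def by blast
  have "C1.pdist (\<beta>1 b \<squnion>\<^bsub>C1\<^esub> \<beta>1 b') (x \<squnion>\<^bsub>C1\<^esub> x') < \<epsilon>"
    using assms b b' C1.pdist_join[of "\<beta>1 b" "\<beta>1 b'" x x'] by simp
  moreover have "C2.pdist (\<beta>2 b \<squnion>\<^bsub>C2\<^esub> \<beta>2 b') (y \<squnion>\<^bsub>C2\<^esub> y') < \<epsilon>"
    using assms b b' C2.pdist_join[of "\<beta>2 b" "\<beta>2 b'" y y'] by simp
  ultimately show "\<exists>b\<in>carrier B. C1.pdist (\<beta>1 b) (x \<squnion>\<^bsub>C1\<^esub> x') < \<epsilon> \<and>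
      C2.pdist (\<beta>2 b) (y \<squnion>\<^bsub>C2\<^esub> y') < \<epsilon>"
    using b b' by (intro bexI[of _ "b \<squnion>\<^bsub>B\<^esub> b'"]) auto
qed

text \<open>
  Finite partial joins are close by \<open>close_join\<close>, and one partial join approximates both countable
  joins at once.
\<close>

lemma close_sup:
  fixes x :: "nat \<Rightarrow> 'b" and y :: "nat \<Rightarrow> 'c"
  assumes x: "\<And>n. x n \<in> carrier C1" and y: "\<And>n. y n \<in> carrier C2"
    and close: "\<And>n. close (x n) (y n)"
  shows "close (\<Squnion>\<^bsub>C1\<^esub>(range x)) (\<Squnion>\<^bsub>C2\<^esub>(range y))"
  unfolding close_def
proof (intro allI impI)
  let ?p = "partial_join C1 x" and ?q = "partial_join C2 y"
  have p: "?p n \<in> carrier C1" and q: "?q n \<in> carrier C2" for n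
    using x y C1.partial_join_closed C2.partial_join_closed by auto
  have s: "\<Squnion>\<^bsub>C1\<^esub>(range x) \<in> carrier C1" "\<Squnion>\<^bsub>C2\<^esub>(range y) \<in> carrier C2"
    using x y by (auto intro!: C1.sup_closed C2.sup_closed)
  have cp: "close (?p n) (?q n)" for n
  proof (induction n)
    case 0
    show ?case using close_generator[OF B.bottom_closed] by simp
  next
    case (Suc n)
    then show ?case using close_join[OF p q Suc x y close] by simp
  qed
  fix \<epsilon> :: real assume "\<epsilon> > 0"
  then have e: "\<epsilon> / 2 > 0" by simp
  have "\<forall>\<^sub>F n in sequentially. C1.pdist (?p n) (\<Squnion>\<^bsub>C1\<^esub>(range x)) < \<epsilon> / 2 \<and>
      C2.pdist (?q n) (\<Squnion>\<^bsub>C2\<^esub>(range y)) < \<epsilon> / 2"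
    using order_tendstoD(2)[OF C1.partial_join_tendsto[OF x] e]
      order_tendstoD(2)[OF C2.partial_join_tendsto[OF y] e] by (rule eventually_conj)
  then obtain n where n: "C1.pdist (?p n) (\<Squnion>\<^bsub>C1\<^esub>(range x)) < \<epsilon> / 2"
      "C2.pdist (?q n) (\<Squnion>\<^bsub>C2\<^esub>(range y)) < \<epsilon> / 2"
    unfolding eventually_sequentially by blast
  obtain b where b: "b \<in> carrier B" "C1.pdist (\<beta>1 b) (?p n) < \<epsilon> / 2" "C2.pdist (\<beta>2 b) (?q n) < \<epsilon> / 2"
    using cp[of n] e unfolding close_def by blast
  have "C1.pdist (\<beta>1 b) (\<Squnion>\<^bsub>C1\<^esub>(range x)) < \<epsilon>"
    using C1.pdist_triangle[OF hom1_closed[OF b(1)] p[of n] s(1)] n b by linarith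
  moreover have "C2.pdist (\<beta>2 b) (\<Squnion>\<^bsub>C2\<^esub>(range y)) < \<epsilon>"
    using C2.pdist_triangle[OF hom2_closed[OF b(1)] q[of n] s(2)] n b by linarith
  ultimately show "\<exists>b\<in>carrier B. C1.pdist (\<beta>1 b) (\<Squnion>\<^bsub>C1\<^esub>(range x)) < \<epsilon> \<and>
      C2.pdist (\<beta>2 b) (\<Squnion>\<^bsub>C2\<^esub>(range y)) < \<epsilon>"
    using b by blast
qed

text \<open>
  The elements with a close partner form a \<open>\<sigma>\<close>-subalgebra that contains the generators. If both
  extensions are the same, this says that the image of \<open>B\<close> is dense in its extension.
\<close>

lemma close_total:
  assumes "x \<in> carrier C1"
  shows "\<exists>y\<in>carrier C2. close x y"
proof -
  have gen: "sigma_generated_by C1 (\<beta>1 ` carrier B)"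
    using ext1 by (simp add: sigma_extension_def)
  show ?thesis
    using gen assms
  proof (induction rule: C1.sigma_generated_induct)
    case (generator x)
    then show ?case using close_generator hom2_closed by blast
  next
    case (complement x)
    then show ?case using close_complement C2.complement_closed by blast
  next
    case (sup A)
    show ?case
    proof (cases "A = {}")
      case True
      then show ?thesis
        using close_generator[OF B.bottom_closed] by (auto simp: C1.sup_empty)
    next
      case False
      then obtain a :: "nat \<Rightarrow> 'b" where a: "A = range a"
        using sup(2) uncountable_def by blast
      then have "\<forall>n. \<exists>y. y \<in> carrier C2 \<and> close (a n) y" using sup(3) by blast
      then obtain y where y: "\<And>n. y n \<in> carrier C2" "\<And>n. close (a n) (y n)"
        by metis
      have "close (\<Squnion>\<^bsub>C1\<^esub>A) (\<Squnion>\<^bsub>C2\<^esub>(range y))"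
        unfolding a using sup(1) y by (intro close_sup) (auto simp: a)
      moreover have "\<Squnion>\<^bsub>C2\<^esub>(range y) \<in> carrier C2"
        using y by (intro C2.sup_closed) auto
      ultimately show ?thesis by blast
    qed
  qed
qed

text \<open>
  Both sides are approximated by the mass of the difference of the same two elements of \<open>B\<close>. The
  four errors, two in each algebra, explain the choice of \<open>\<epsilon> / 4\<close>.
\<close>

lemma mass_difference_le:
  assumes x: "x \<in> carrier C1" "x' \<in> carrier C1" and y: "y \<in> carrier C2" "y' \<in> carrier C2"
    and close: "close x y" "close x' y'"
  shows "C2.mass (difference C2 y y') \<le> C1.mass (difference C1 x x')"
proof (rule field_le_epsilon)
  fix \<epsilon> :: real assume "\<epsilon> > 0"
  then have e: "\<epsilon> / 4 > 0" by simp
  obtain b where b: "b \<in> carrier B" "C1.pdist (\<beta>1 b) x < \<epsilon> / 4" "C2.pdist (\<beta>2 b) y < \<epsilon> / 4"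
    using close(1) e unfolding close_def by blast
  obtain b' where b': "b' \<in> carrier B" "C1.pdist (\<beta>1 b') x' < \<epsilon> / 4" "C2.pdist (\<beta>2 b') y' < \<epsilon> / 4"
    using close(2) e unfolding close_def by blast
  have "C2.mass (difference C2 y y') \<le>
      C2.pdist (\<beta>2 b) y + B.mass (difference B b b') + C2.pdist (\<beta>2 b') y'"
    using C2.mass_difference_perturb[of y y' "\<beta>2 b" "\<beta>2 b'"] b b' y by (simp add: mass2_difference)
  moreover have "B.mass (difference B b b') \<le>
      C1.pdist (\<beta>1 b) x + C1.mass (difference C1 x x') + C1.pdist (\<beta>1 b') x'"
    using C1.mass_difference_perturb[of "\<beta>1 b" "\<beta>1 b'" x x'] b b' x
    by (simp add: mass1_difference C1.pdist_sym[of x] C1.pdist_sym[of x'])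
  ultimately show "C2.mass (difference C2 y y') \<le> C1.mass (difference C1 x x') + \<epsilon>"
    using b b' by linarith
qed

lemma mass_difference_eq:
  assumes "x \<in> carrier C1" "x' \<in> carrier C1" "y \<in> carrier C2" "y' \<in> carrier C2"
    and "close x y" "close x' y'"
  shows "C2.mass (difference C2 y y') = C1.mass (difference C1 x x')"
  using mass_difference_le[OF assms]
    extension_pair.mass_difference_le[OF swap assms(3,4,1,2)] assms(5,6)
  by (simp add: close_swap)

text \<open>
  The bottom elements are close, and an element is its own difference from \<open>\<bottom>\<close>.
\<close>

lemma measure_eq_of_close:
  assumes "x \<in> carrier C1" "y \<in> carrier C2" "close x y"
  shows "\<mu>2 y = \<mu>1 x"
proof -
  have "difference C1 x \<bottom>\<^bsub>C1\<^esub> = x" "difference C2 y \<bottom>\<^bsub>C2\<^esub> = y"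
    using assms by (auto simp flip: C1.stone_eq_iff C2.stone_eq_iff)
  then have "C2.mass y = C1.mass x"
    using mass_difference_eq[of x "\<bottom>\<^bsub>C1\<^esub>" y "\<bottom>\<^bsub>C2\<^esub>"] assms
      close_generator[OF B.bottom_closed] by simp
  with assms show ?thesis by (simp flip: C1.ennreal_mass C2.ennreal_mass)
qed

text \<open>
  By \<open>mass_difference_eq\<close> and reducedness, closeness preserves and reflects the order. So it is
  single-valued in both directions, and by \<open>close_total\<close> it is total in both directions.
\<close>

lemma isomorphism_exists:
  assumes red: "reduced C1 \<mu>1" "reduced C2 \<mu>2"
  obtains \<phi> where "\<phi> \<in> extensional (carrier C1)" "sigma_iso C1 C2 \<phi>"
    "\<forall>b\<in>carrier B. \<phi> (\<beta>1 b) = \<beta>2 b" "\<forall>x\<in>carrier C1. \<mu>2 (\<phi> x) = \<mu>1 x"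
proof -
  have le_iff: "x \<sqsubseteq>\<^bsub>C1\<^esub> x' \<longleftrightarrow> y \<sqsubseteq>\<^bsub>C2\<^esub> y'"
    if "x \<in> carrier C1" "x' \<in> carrier C1" "y \<in> carrier C2" "y' \<in> carrier C2"
      "close x y" "close x' y'" for x x' y y'
    using mass_difference_eq[OF that] that(1-4)
    by (simp add: C1.reduced_le_iff[OF red(1)] C2.reduced_le_iff[OF red(2)])
  have unique2: "y = y'"
    if "x \<in> carrier C1" "y \<in> carrier C2" "y' \<in> carrier C2" "close x y" "close x y'" for x y y'
    using le_iff[of x x y y'] le_iff[of x x y' y] that by (intro C2.le_antisym) auto
  have unique1: "x = x'"
    if "x \<in> carrier C1" "x' \<in> carrier C1" "y \<in> carrier C2" "close x y" "close x' y" for x x' y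
    using le_iff[of x x' y y] le_iff[of x' x y y] that by (intro C1.le_antisym) auto
  have "\<forall>x. x \<in> carrier C1 \<longrightarrow> (\<exists>y. y \<in> carrier C2 \<and> close x y)"
    using close_total by blast
  then obtain f where f: "\<And>x. x \<in> carrier C1 \<Longrightarrow> f x \<in> carrier C2 \<and> close x (f x)"
    by metis
  have "\<forall>y. y \<in> carrier C2 \<longrightarrow> (\<exists>x. x \<in> carrier C1 \<and> close x y)"
    using extension_pair.close_total[OF swap] by (simp add: close_swap) blast
  then obtain g where g: "\<And>y. y \<in> carrier C2 \<Longrightarrow> g y \<in> carrier C1 \<and> close (g y) y"
    by metis
  define \<phi> where "\<phi> = restrict f (carrier C1)"
  have \<phi>: "\<phi> x \<in> carrier C2" "close x (\<phi> x)" if "x \<in> carrier C1" for x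
    using f that by (auto simp: \<phi>_def)
  have \<phi>g: "\<phi> (g y) = y" if "y \<in> carrier C2" for y
    using unique2[of "g y" "\<phi> (g y)" y] g[OF that] \<phi>[of "g y"] that by simp
  have g\<phi>: "g (\<phi> x) = x" if "x \<in> carrier C1" for x
    using unique1[of "g (\<phi> x)" x "\<phi> x"] g[of "\<phi> x"] \<phi>[OF that] that by simp
  have \<phi>_mono: "\<phi> x \<sqsubseteq>\<^bsub>C2\<^esub> \<phi> x'" if "x \<in> carrier C1" "x' \<in> carrier C1" "x \<sqsubseteq>\<^bsub>C1\<^esub> x'" for x x'
    using le_iff[of x x' "\<phi> x" "\<phi> x'"] \<phi> that by blast
  have g_mono: "g y \<sqsubseteq>\<^bsub>C1\<^esub> g y'" if "y \<in> carrier C2" "y' \<in> carrier C2" "y \<sqsubseteq>\<^bsub>C2\<^esub> y'" for y y'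
    using le_iff[of "g y" "g y'" y y'] g that by blast
  have "sigma_hom C1 C2 \<phi>"
    by (rule order_iso_sigma_hom[of _ _ _ g])
      (use C1.abstract_sigma_algebra_axioms C2.abstract_sigma_algebra_axioms \<phi> g \<phi>g g\<phi> \<phi>_mono g_mono in auto)
  moreover have "sigma_hom C2 C1 g"
    by (rule order_iso_sigma_hom[of _ _ _ \<phi>])
      (use C1.abstract_sigma_algebra_axioms C2.abstract_sigma_algebra_axioms \<phi> g \<phi>g g\<phi> \<phi>_mono g_mono in auto)
  ultimately have "sigma_iso C1 C2 \<phi>"
    unfolding sigma_iso_def using \<phi>g g\<phi> by blast
  moreover have "\<phi> (\<beta>1 b) = \<beta>2 b" if "b \<in> carrier B" for b
    using unique2[of "\<beta>1 b" "\<phi> (\<beta>1 b)" "\<beta>2 b"] \<phi>[of "\<beta>1 b"] that close_generator by simp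
  moreover have "\<mu>2 (\<phi> x) = \<mu>1 x" if "x \<in> carrier C1" for x
    using measure_eq_of_close \<phi> that by blast
  moreover have "\<phi> \<in> extensional (carrier C1)"
    by (simp add: \<phi>_def)
  ultimately show ?thesis using that by blast
qed

end

section \<open>Quotients of measure spaces by sigma-ideals of null sets\<close>

text \<open>
  \<open>N\<close> is a \<open>\<sigma>\<close>-ideal of null sets, and \<open>q\<close> is an arbitrary coding of the classes
  modulo \<open>N\<close>. Leaving the coding open allows classes to be represented in a prescribed type; with
  \<open>N = {{}}\<close> and \<open>q\<close> the identity, the quotient is the \<open>\<sigma>\<close>-algebra of measurable sets itself.
\<close>

locale null_quotient =
  fixes M :: "'x measure" and N :: "'x set set" and q :: "'x set \<Rightarrow> 'q"
  assumes null: "N \<subseteq> null_sets M"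
    and null_subset: "A \<in> N \<Longrightarrow> D \<in> sets M \<Longrightarrow> D \<subseteq> A \<Longrightarrow> D \<in> N"
    and null_Union: "countable \<A> \<Longrightarrow> \<A> \<subseteq> N \<Longrightarrow> \<Union>\<A> \<in> N"
    and q_eq_iff: "A \<in> sets M \<Longrightarrow> D \<in> sets M \<Longrightarrow> q A = q D \<longleftrightarrow> A - D \<in> N \<and> D - A \<in> N"
begin

definition quot :: "'q gorder" where
  "quot = \<lparr>carrier = q ` sets M, eq = (=),
     le = (\<lambda>X Y. \<exists>A\<in>sets M. \<exists>D\<in>sets M. X = q A \<and> Y = q D \<and> A - D \<in> N)\<rparr>"

text \<open>
  The value does not depend on the representative, since representatives differ by null sets; see
  \<open>quotient_measure_q\<close>.
\<close>

definition quotient_measure :: "'q \<Rightarrow> ennreal" where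
  "quotient_measure X = emeasure M (SOME A. A \<in> sets M \<and> q A = X)"

lemma carrier_quot: "carrier quot = q ` sets M"
  by (simp add: quot_def)

lemma q_closed [simp]: "A \<in> sets M \<Longrightarrow> q A \<in> carrier quot"
  by (simp add: carrier_quot)

lemma null_empty [simp]: "{} \<in> N"
  using null_Union[of "{}"] by simp

lemma null_diff_subset [simp]: "A \<subseteq> D \<Longrightarrow> A - D \<in> N"
  by (metis Diff_eq_empty_iff null_empty)

lemma null_Un: "A \<in> N \<Longrightarrow> D \<in> N \<Longrightarrow> A \<union> D \<in> N"
  using null_Union[of "{A, D}"] by simp

lemma null_diff_trans:
  assumes "A \<in> sets M" "C \<in> sets M" "A - D \<in> N" "D - C \<in> N"
  shows "A - C \<in> N"
  by (rule null_subset[OF null_Un[OF assms(3,4)]]) (use assms in auto)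

lemma le_iff:
  assumes "A \<in> sets M" "D \<in> sets M"
  shows "q A \<sqsubseteq>\<^bsub>quot\<^esub> q D \<longleftrightarrow> A - D \<in> N"
proof
  assume "q A \<sqsubseteq>\<^bsub>quot\<^esub> q D"
  then obtain A' D' where "A' \<in> sets M" "D' \<in> sets M" "q A = q A'" "q D = q D'" "A' - D' \<in> N"
    by (auto simp: quot_def)
  with assms show "A - D \<in> N"
    by (metis null_diff_trans q_eq_iff)
qed (use assms in \<open>auto simp: quot_def\<close>)

sublocale po: partial_order quot
proof (unfold_locales)
  show "(.=\<^bsub>quot\<^esub>) = (=)" by (simp add: quot_def)
  show "x .=\<^bsub>quot\<^esub> x" if "x \<in> carrier quot" for x by (simp add: quot_def)
  show "y .=\<^bsub>quot\<^esub> x" if "x .=\<^bsub>quot\<^esub> y" for x y using that by (simp add: quot_def)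
  show "x .=\<^bsub>quot\<^esub> z" if "x .=\<^bsub>quot\<^esub> y" "y .=\<^bsub>quot\<^esub> z" for x y z using that by (simp add: quot_def)
  show "x \<sqsubseteq>\<^bsub>quot\<^esub> x" if "x \<in> carrier quot" for x
    using that by (auto simp: carrier_quot le_iff)
  show "x .=\<^bsub>quot\<^esub> y" if "x \<sqsubseteq>\<^bsub>quot\<^esub> y" "y \<sqsubseteq>\<^bsub>quot\<^esub> x" "x \<in> carrier quot" "y \<in> carrier quot" for x y
  proof -
    have "x = y" using that by (auto simp: carrier_quot le_iff q_eq_iff)
    then show ?thesis by (simp add: quot_def)
  qed
  show "x \<sqsubseteq>\<^bsub>quot\<^esub> z" if "x \<sqsubseteq>\<^bsub>quot\<^esub> y" "y \<sqsubseteq>\<^bsub>quot\<^esub> z" "x \<in> carrier quot" "y \<in> carrier quot" "z \<in> carrier quot" for x y z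
    using that by (auto simp: carrier_quot le_iff intro: null_diff_trans)
  show "x \<sqsubseteq>\<^bsub>quot\<^esub> z \<longleftrightarrow> y \<sqsubseteq>\<^bsub>quot\<^esub> w" if "x .=\<^bsub>quot\<^esub> y" "z .=\<^bsub>quot\<^esub> w" for x y z w
    using that by (simp add: quot_def)
qed

lemma lub_Union:
  assumes "\<A> \<subseteq> sets M" "countable \<A>"
  shows "least quot (q (\<Union>\<A>)) (Upper quot (q ` \<A>))"
proof (rule least_UpperI)
  have U: "\<Union>\<A> \<in> sets M" using assms by (simp add: sets.countable_Union)
  then show "q (\<Union>\<A>) \<in> carrier quot" by simp
  show sub: "q ` \<A> \<subseteq> carrier quot" using assms by (auto simp: carrier_quot)
  show "X \<sqsubseteq>\<^bsub>quot\<^esub> q (\<Union>\<A>)" if X: "X \<in> q ` \<A>" for X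
  proof -
    obtain A where A: "A \<in> \<A>" "X = q A" using X by blast
    with assms have "A \<in> sets M" "A \<subseteq> \<Union>\<A>" by auto
    with A U show ?thesis by (simp add: le_iff)
  qed
  fix Y assume Y: "Y \<in> Upper quot (q ` \<A>)"
  then have "Y \<in> carrier quot" using Upper_closed[of quot "q ` \<A>"] by blast
  then obtain D where D: "D \<in> sets M" "Y = q D" by (auto simp: carrier_quot)
  have "A - D \<in> N" if "A \<in> \<A>" for A
  proof -
    have "q A \<sqsubseteq>\<^bsub>quot\<^esub> q D" using Upper_memD[OF Y _ sub] that D by blast
    moreover have "A \<in> sets M" using that assms by blast
    ultimately show ?thesis using D by (simp add: le_iff)
  qed
  then have "\<Union>((\<lambda>A. A - D) ` \<A>) \<in> N"
    using assms by (intro null_Union) auto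
  moreover have "\<Union>((\<lambda>A. A - D) ` \<A>) = \<Union>\<A> - D" by blast
  ultimately have "\<Union>\<A> - D \<in> N" by simp
  with U D show "q (\<Union>\<A>) \<sqsubseteq>\<^bsub>quot\<^esub> Y" by (simp add: le_iff)
qed

lemma sup_q:
  assumes "\<A> \<subseteq> sets M" "countable \<A>"
  shows "\<Squnion>\<^bsub>quot\<^esub>(q ` \<A>) = q (\<Union>\<A>)"
  unfolding Lattice.sup_def
  by (rule some_equality) (use lub_Union[OF assms] po.least_unique in blast)+

lemma join_q:
  assumes "A \<in> sets M" "D \<in> sets M" shows "q A \<squnion>\<^bsub>quot\<^esub> q D = q (A \<union> D)"
  using sup_q[of "{A, D}"] assms by (simp add: join_def)

lemma glb_Int:
  assumes A: "A \<in> sets M" and D: "D \<in> sets M"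
  shows "greatest quot (q (A \<inter> D)) (Lower quot {q A, q D})"
proof (rule greatest_LowerI)
  show "q (A \<inter> D) \<in> carrier quot" and sub: "{q A, q D} \<subseteq> carrier quot"
    using assms by auto
  show "q (A \<inter> D) \<sqsubseteq>\<^bsub>quot\<^esub> X" if "X \<in> {q A, q D}" for X
    using that assms by (auto simp: le_iff Diff_eq Int_commute Int_left_commute)
  fix Y assume Y: "Y \<in> Lower quot {q A, q D}"
  then have "Y \<in> carrier quot" using Lower_closed[of quot "{q A, q D}"] by blast
  then obtain C where C: "C \<in> sets M" "Y = q C" by (auto simp: carrier_quot)
  have "q C \<sqsubseteq>\<^bsub>quot\<^esub> q A" "q C \<sqsubseteq>\<^bsub>quot\<^esub> q D"
    using Lower_memD[OF Y _ sub] C by auto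
  then have "(C - A) \<union> (C - D) \<in> N"
    using A D C by (intro null_Un) (auto simp: le_iff)
  then have "C - A \<inter> D \<in> N" by (simp add: Diff_Int)
  with A D C show "Y \<sqsubseteq>\<^bsub>quot\<^esub> q (A \<inter> D)" by (simp add: le_iff)
qed

lemma meet_q:
  assumes "A \<in> sets M" "D \<in> sets M" shows "q A \<sqinter>\<^bsub>quot\<^esub> q D = q (A \<inter> D)"
  unfolding meet_def Lattice.inf_def
  by (rule some_equality) (use glb_Int[OF assms] po.greatest_unique in blast)+

lemma least_q_empty: "least quot (q {}) (carrier quot)"
  using lub_Union[of "{}"] by simp

lemma greatest_q_space: "greatest quot (q (space M)) (carrier quot)"
  by (auto simp: greatest_def carrier_quot le_iff sets.sets_into_space)

lemma bottom_q: "\<bottom>\<^bsub>quot\<^esub> = q {}"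
  unfolding bottom_def
  by (rule some_equality) (use least_q_empty po.least_unique in blast)+

lemma top_q: "\<top>\<^bsub>quot\<^esub> = q (space M)"
  unfolding top_def
  by (rule some_equality) (use greatest_q_space po.greatest_unique in blast)+

sublocale abstract_sigma_algebra quot
proof (unfold_locales)
  show "\<exists>s. least quot s (Upper quot {x, y})" if xy: "x \<in> carrier quot" "y \<in> carrier quot" for x y
  proof -
    obtain A D where "A \<in> sets M" "D \<in> sets M" "x = q A" "y = q D"
      using xy by (auto simp: carrier_quot)
    then show ?thesis using lub_Union[of "{A, D}"] by auto
  qed
  show "\<exists>s. greatest quot s (Lower quot {x, y})" if "x \<in> carrier quot" "y \<in> carrier quot" for x y
    using that glb_Int by (auto simp: carrier_quot)
  show "\<exists>x. least quot x (carrier quot)" "\<exists>x. greatest quot x (carrier quot)"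
    using least_q_empty greatest_q_space by blast+
  show "x \<sqinter>\<^bsub>quot\<^esub> (y \<squnion>\<^bsub>quot\<^esub> z) = x \<sqinter>\<^bsub>quot\<^esub> y \<squnion>\<^bsub>quot\<^esub> (x \<sqinter>\<^bsub>quot\<^esub> z)"
    if "x \<in> carrier quot" "y \<in> carrier quot" "z \<in> carrier quot" for x y z
    using that by (auto simp: carrier_quot join_q meet_q Int_Un_distrib)
  show "\<exists>y\<in>carrier quot. x \<sqinter>\<^bsub>quot\<^esub> y = \<bottom>\<^bsub>quot\<^esub> \<and> x \<squnion>\<^bsub>quot\<^esub> y = \<top>\<^bsub>quot\<^esub>" if x: "x \<in> carrier quot" for x
  proof -
    obtain A where A: "A \<in> sets M" "x = q A" using x by (auto simp: carrier_quot)
    moreover have "A \<inter> (space M - A) = {}" "A \<union> (space M - A) = space M"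
      using A sets.sets_into_space by auto
    ultimately show ?thesis
      by (intro bexI[of _ "q (space M - A)"]) (simp_all add: join_q meet_q bottom_q top_q sets.compl_sets)
  qed
  show "\<exists>s. least quot s (Upper quot A)" if A: "A \<subseteq> carrier quot" "countable A" for A
  proof -
    obtain \<A> where "\<A> \<subseteq> sets M" "countable \<A>" "A = q ` \<A>"
      using A countable_subset_image[of A q "sets M"] by (auto simp: carrier_quot)
    then show ?thesis using lub_Union by blast
  qed
qed

lemma complement_q:
  assumes A: "A \<in> sets M" shows "complement quot (q A) = q (space M - A)"
proof (rule complement_eqI)
  have "A \<inter> (space M - A) = {}" "A \<union> (space M - A) = space M"
    using A sets.sets_into_space by auto
  with A show "q A \<sqinter>\<^bsub>quot\<^esub> q (space M - A) = \<bottom>\<^bsub>quot\<^esub>" "q A \<squnion>\<^bsub>quot\<^esub> q (space M - A) = \<top>\<^bsub>quot\<^esub>"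
    by (simp_all add: join_q meet_q bottom_q top_q sets.compl_sets)
qed (use A in auto)

lemma symm_diff_q:
  assumes "A \<in> sets M" "D \<in> sets M"
  shows "symm_diff quot (q A) (q D) = q (sym_diff A D)"
proof -
  have "A \<inter> (space M - D) = A - D" "D \<inter> (space M - A) = D - A"
    using assms sets.sets_into_space by blast+
  then show ?thesis
    using assms by (simp add: symm_diff_def difference_def complement_q join_q meet_q sets.compl_sets sets.Diff)
qed

lemma quotient_measure_q:
  assumes A: "A \<in> sets M" shows "quotient_measure (q A) = emeasure M A"
proof -
  have le: "emeasure M C \<le> emeasure M D" if "C \<in> sets M" "D \<in> sets M" "C - D \<in> N" for C D
  proof -
    have "emeasure M C \<le> emeasure M (D \<union> (C - D))"
      using that by (intro emeasure_mono) auto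
    also have "\<dots> = emeasure M D"
      using that null by (intro emeasure_Un_null_set) auto
    finally show ?thesis .
  qed
  define D where "D = (SOME D. D \<in> sets M \<and> q D = q A)"
  have "D \<in> sets M \<and> q D = q A"
    unfolding D_def by (rule someI_ex) (use A in blast)
  with A have "emeasure M D = emeasure M A"
    using q_eq_iff[of D A] le[of A D] le[of D A] by auto
  then show ?thesis by (simp add: quotient_measure_def D_def)
qed

text \<open>
  Representatives of disjoint elements may overlap in a null set, so they are made disjoint before
  countable additivity of \<open>M\<close> is used; this does not change their classes.
\<close>

lemma abstract_measure_quotient: "abstract_measure quot quotient_measure"
  unfolding abstract_measure_def
proof (intro conjI allI impI)
  show "quotient_measure \<bottom>\<^bsub>quot\<^esub> = 0"
    by (simp add: bottom_q quotient_measure_q)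
  fix a :: "nat \<Rightarrow> 'q"
  assume a: "range a \<subseteq> carrier quot \<and> (\<forall>i j. i \<noteq> j \<longrightarrow> a i \<sqinter>\<^bsub>quot\<^esub> a j = \<bottom>\<^bsub>quot\<^esub>)"
  then have "a i \<in> q ` sets M" for i by (auto simp: carrier_quot)
  then have "\<forall>i. \<exists>A. A \<in> sets M \<and> a i = q A" by blast
  then obtain A where A: "\<And>i. A i \<in> sets M" "\<And>i. a i = q (A i)" by metis
  have inter: "A i \<inter> A j \<in> N" if "i \<noteq> j" for i j
  proof -
    have "q (A i \<inter> A j) = q {}" using a A that by (simp add: meet_q bottom_q)
    then show ?thesis using A by (subst (asm) q_eq_iff) auto
  qed
  have dis: "range (disjointed A) \<subseteq> sets M"
    using A by (intro sets.range_disjointed_sets) auto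
  have a_eq: "a n = q (disjointed A n)" for n
  proof -
    have u: "\<Union>((\<lambda>i. A i \<inter> A n) ` {..<n}) \<in> N"
      using inter by (intro null_Union) auto
    have "A n - disjointed A n \<subseteq> \<Union>((\<lambda>i. A i \<inter> A n) ` {..<n})"
      by (auto simp: disjointed_def)
    then have "A n - disjointed A n \<in> N"
      using A dis by (intro null_subset[OF u]) auto
    moreover have "disjointed A n - A n \<in> N" by (simp add: disjointed_subset)
    ultimately show ?thesis
      using A dis by (simp add: q_eq_iff image_subset_iff)
  qed
  have "range a = q ` range A" using A by auto
  then have "\<Squnion>\<^bsub>quot\<^esub>(range a) = q (\<Union>i. A i)"
    using sup_q[of "range A"] A by auto
  then have "quotient_measure (\<Squnion>\<^bsub>quot\<^esub>(range a)) = emeasure M (\<Union>i. disjointed A i)"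
    using A by (simp add: quotient_measure_q UN_disjointed_eq)
  also have "\<dots> = (\<Sum>i. emeasure M (disjointed A i))"
    using suminf_emeasure[OF dis disjoint_family_disjointed] by simp
  also have "\<dots> = (\<Sum>i. quotient_measure (a i))"
    using dis by (intro suminf_cong) (simp add: a_eq quotient_measure_q image_subset_iff)
  finally show "quotient_measure (\<Squnion>\<^bsub>quot\<^esub>(range a)) = (\<Sum>i. quotient_measure (a i))" .
qed

lemma sigma_generated_quotient:
  assumes "sets M = sigma_sets (space M) G"
  shows "sigma_generated_by quot (q ` G)"
  unfolding sigma_generated_by_def
proof (intro conjI allI impI)
  have G: "G \<subseteq> sets M" using assms by auto
  then show "q ` G \<subseteq> carrier quot" by (auto simp: carrier_quot)
  fix S assume S: "q ` G \<subseteq> S \<and> S \<subseteq> carrier quot \<and> \<bottom>\<^bsub>quot\<^esub> \<in> S \<and> \<top>\<^bsub>quot\<^esub> \<in> S \<and>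
    (\<forall>x\<in>S. complement quot x \<in> S) \<and> (\<forall>A. A \<subseteq> S \<and> countable A \<longrightarrow> \<Squnion>\<^bsub>quot\<^esub>A \<in> S)"
  then have gen: "q ` G \<subseteq> S" and sub: "S \<subseteq> carrier quot" and bot: "\<bottom>\<^bsub>quot\<^esub> \<in> S"
    and compl: "\<And>x. x \<in> S \<Longrightarrow> complement quot x \<in> S"
    and sup: "\<And>A. A \<subseteq> S \<Longrightarrow> countable A \<Longrightarrow> \<Squnion>\<^bsub>quot\<^esub>A \<in> S"
    by simp_all
  have "q A \<in> S" if "A \<in> sigma_sets (space M) G" for A
    using that
  proof induction
    case (Basic A)
    then show ?case using gen by blast
  next
    case Empty
    then show ?case using bot by (simp add: bottom_q)
  next
    case (Compl A)
    then have "A \<in> sets M" using assms by simp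
    then show ?case using compl[OF Compl.IH] by (simp add: complement_q)
  next
    case (Union A)
    then have "range A \<subseteq> sets M" using assms by auto
    then have "\<Squnion>\<^bsub>quot\<^esub>(q ` range A) = q (\<Union>i. A i)" by (intro sup_q) auto
    moreover have "\<Squnion>\<^bsub>quot\<^esub>(q ` range A) \<in> S" using Union by (intro sup) auto
    ultimately show ?case by simp
  qed
  then have "carrier quot \<subseteq> S" using assms by (auto simp: carrier_quot)
  with sub show "S = carrier quot" by (rule equalityI)
qed

lemma reduced_quotient:
  assumes "null_sets M \<subseteq> N" shows "reduced quot quotient_measure"
  unfolding reduced_def
proof (intro ballI impI)
  fix x assume "x \<in> carrier quot" "quotient_measure x = 0"
  then obtain A where A: "A \<in> sets M" "x = q A" "emeasure M A = 0"
    by (auto simp: carrier_quot quotient_measure_q)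
  then have "A \<in> N" using assms by auto
  with A show "x = \<bottom>\<^bsub>quot\<^esub>" by (simp add: bottom_q q_eq_iff)
qed

end

section \<open>Existence of the reduced completion\<close>

text \<open>
  The continuity hypothesis of Caratheodory's theorem holds trivially: by compactness, a decreasing
  sequence of clopen sets with empty intersection is empty from some index on.
\<close>

lemma (in finite_content) stone_measure_exists:
  obtains M where "space M = ultrafilters L"
    "sets M = sigma_sets (ultrafilters L) (stone L ` carrier L)"
    "\<And>x. x \<in> carrier L \<Longrightarrow> emeasure M (stone L x) = \<mu> x"
proof -
  let ?\<Omega> = "ultrafilters L" and ?A = "stone L ` carrier L"
  define f where "f X = \<mu> (the_inv_into (carrier L) (stone L) X)" for X
  have inj: "inj_on (stone L) (carrier L)"
    by (auto simp: inj_on_def stone_eq_iff)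
  have f: "f (stone L x) = \<mu> x" if "x \<in> carrier L" for x
    using that by (simp add: f_def the_inv_into_f_f[OF inj])
  interpret ring_of_sets ?\<Omega> ?A
  proof (rule ring_of_setsI)
    show "?A \<subseteq> Pow ?\<Omega>" using stone_subset by auto
    show "{} \<in> ?A" using stone_bottom bottom_closed by (metis imageI)
    show "X \<union> Y \<in> ?A" if "X \<in> ?A" "Y \<in> ?A" for X Y
      using that stone_join join_closed by (auto simp del: stone_join simp flip: stone_join)
    show "X - Y \<in> ?A" if "X \<in> ?A" "Y \<in> ?A" for X Y
      using that by (auto simp del: stone_difference simp flip: stone_difference)
  qed
  have "\<exists>\<nu>. (\<forall>X\<in>?A. \<nu> X = f X) \<and> measure_space ?\<Omega> (sigma_sets ?\<Omega> ?A) \<nu>"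
  proof (rule caratheodory_empty_continuous)
    show "positive ?A f"
      using f[OF bottom_closed] by (simp add: positive_def content_bottom)
    show "additive ?A f"
      unfolding additive_def
    proof (intro ballI impI)
      fix X Y assume "X \<in> ?A" "Y \<in> ?A" and disj: "X \<inter> Y = {}"
      then obtain x y where "x \<in> carrier L" "y \<in> carrier L" "X = stone L x" "Y = stone L y"
        by blast
      with disj show "f (X \<union> Y) = f X + f Y"
        using content_disjoint[of x y "x \<squnion> y"] f[of "x \<squnion> y"] by (simp add: f)
    qed
    show "f X \<noteq> \<infinity>" if "X \<in> ?A" for X
      by (metis that content_finite f imageE less_irrefl)
  next
    fix X :: "nat \<Rightarrow> 'a set set"
    assume X: "range X \<subseteq> ?A" and dec: "decseq X" and empty: "(\<Inter>i. X i) = {}"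
    have "\<forall>i. \<exists>a. a \<in> carrier L \<and> X i = stone L a" using X by blast
    then obtain a where a: "\<And>i. a i \<in> carrier L" "\<And>i. X i = stone L (a i)" by metis
    have "a (Suc n) \<sqsubseteq> a n" for n
      using decseqD[OF dec, of n "Suc n"] a by (simp add: stone_subset_iff)
    then obtain n where "a n = \<bottom>"
      using stone_decreasing_empty[of a] a empty by auto
    then have "X i = {}" if "i \<ge> n" for i
      using decseqD[OF dec that] a[of n] by simp
    then have "f (X i) = 0" if "i \<ge> n" for i
      using that f[OF bottom_closed] content_bottom by simp
    then have "\<forall>\<^sub>F i in sequentially. f (X i) = 0"
      unfolding eventually_sequentially by blast
    then show "(\<lambda>i. f (X i)) \<longlonglongrightarrow> 0" by (rule tendsto_eventually)
  qed
  then obtain \<nu> where \<nu>: "\<And>X. X \<in> ?A \<Longrightarrow> \<nu> X = f X" "measure_space ?\<Omega> (sigma_sets ?\<Omega> ?A) \<nu>"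
    by blast
  define M where "M = measure_of ?\<Omega> (sigma_sets ?\<Omega> ?A) \<nu>"
  have sub: "sigma_sets ?\<Omega> ?A \<subseteq> Pow ?\<Omega>"
    using sigma_sets_into_sp[of ?A ?\<Omega>] stone_subset by blast
  show ?thesis
  proof
    show "space M = ?\<Omega>" by (simp add: M_def space_measure_of[OF sub])
    show "sets M = sigma_sets ?\<Omega> ?A"
      by (simp add: M_def sub sigma_sets_sigma_sets_eq[OF space_closed])
    show "emeasure M (stone L x) = \<mu> x" if "x \<in> carrier L" for x
      using that \<nu> f unfolding M_def
      by (subst emeasure_measure_of_sigma) (auto simp: measure_space_def)
  qed
qed

locale stone_quotient = B: finite_content B \<mu>\<^sub>0 + null_quotient M N q
  for B :: "('a, 'm) gorder_scheme" and \<mu>\<^sub>0 and M :: "'a set measure" and N and q :: "'a set set \<Rightarrow> 'q" +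
  assumes space_M: "space M = ultrafilters B"
    and sets_M: "sets M = sigma_sets (ultrafilters B) (stone B ` carrier B)"
    and emeasure_M: "\<And>x. x \<in> carrier B \<Longrightarrow> emeasure M (stone B x) = \<mu>\<^sub>0 x"
begin

lemma stone_sets [simp]: "b \<in> carrier B \<Longrightarrow> stone B b \<in> sets M"
  by (simp add: sets_M)

lemma sigma_extension_quotient:
  "sigma_extension B \<mu>\<^sub>0 (\<lambda>b. q (stone B b)) quot quotient_measure"
  unfolding sigma_extension_def
proof (intro conjI ballI)
  show "abstract_sigma_algebra quot" by (rule abstract_sigma_algebra_axioms)
  show "abstract_measure quot quotient_measure" by (rule abstract_measure_quotient)
  show "boolean_hom B quot (\<lambda>b. q (stone B b))"
    by (auto simp: boolean_hom_def bottom_q top_q complement_q join_q meet_q space_M)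
  show "sigma_generated_by quot ((\<lambda>b. q (stone B b)) ` carrier B)"
    using sigma_generated_quotient[of "stone B ` carrier B"] by (simp add: sets_M space_M image_image)
  show "quotient_measure (q (stone B b)) = \<mu>\<^sub>0 b" if "b \<in> carrier B" for b
    using that by (simp add: quotient_measure_q emeasure_M)
qed

text \<open>
  Totality of closeness for the quotient paired with itself: an element of \<open>B\<close> near \<open>q A\<close> and
  its partner is in particular near \<open>q A\<close>.
\<close>

lemma stone_dense:
  assumes A: "A \<in> sets M" and \<epsilon>: "\<epsilon> > 0"
  shows "\<exists>b\<in>carrier B. measure M (sym_diff (stone B b) A) < \<epsilon>"
proof -
  interpret P: extension_pair B \<mu>\<^sub>0 quot "\<lambda>b. q (stone B b)" quotient_measure
      quot "\<lambda>b. q (stone B b)" quotient_measure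
    by (rule extension_pair.intro[OF B.finite_content_axioms sigma_extension_quotient
          sigma_extension_quotient])
  obtain Y where "P.close (q A) Y" using P.close_total[of "q A"] A by auto
  then obtain b where b: "b \<in> carrier B" "P.C1.pdist (q (stone B b)) (q A) < \<epsilon>"
    using \<epsilon> unfolding P.close_def by blast
  moreover have "sym_diff (stone B b) A \<in> sets M"
    by (intro sets.Un sets.Diff A stone_sets b(1))
  ultimately have "measure M (sym_diff (stone B b) A) < \<epsilon>"
    using A by (simp add: P.C1.mass_def symm_diff_q quotient_measure_q measure_def)
  with b show ?thesis by blast
qed

end

lemma (in finite_measure) measure_symm_diff_triangle:
  assumes "A \<in> sets M" "D \<in> sets M" "C \<in> sets M"
  shows "measure M (sym_diff A C) \<le>
    measure M (sym_diff A D) + measure M (sym_diff D C)"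
proof -
  have "measure M (sym_diff A C) \<le>
      measure M ((sym_diff A D) \<union> (sym_diff D C))"
    using assms by (intro finite_measure_mono) auto
  also have "\<dots> \<le> measure M (sym_diff A D) + measure M (sym_diff D C)"
    using assms by (intro measure_Un_le) auto
  finally show ?thesis .
qed

text \<open>
  Two measurable sets have a common approximating sequence only if their symmetric difference is null,
  and each has at least one such sequence by density. So the set of approximating sequences determines
  the class modulo null sets.
\<close>

lemma (in finite_content) reduced_completion_exists:
  "\<exists>(C :: (nat \<Rightarrow> 'a) set gorder) \<beta> \<nu>. reduced_completion L \<mu> \<beta> C \<nu>"
proof -
  obtain M where space: "space M = ultrafilters L"
    and sets: "sets M = sigma_sets (ultrafilters L) (stone L ` carrier L)"
    and emeasure: "\<And>x. x \<in> carrier L \<Longrightarrow> emeasure M (stone L x) = \<mu> x"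
    using stone_measure_exists by blast
  have M: "stone_quotient_axioms L \<mu> M"
    by (rule stone_quotient_axioms.intro) (use space sets emeasure in auto)
  have "emeasure M (space M) \<noteq> \<infinity>"
    using emeasure[OF top_closed] finite_top by (simp add: space less_top)
  then interpret finite_measure M by (rule finite_measureI)
  \<comment> \<open>the zero ideal, which only serves to supply density of the clopen sets\<close>
  interpret S: stone_quotient L \<mu> M "{{}}" "\<lambda>A. A"
    by (intro stone_quotient.intro finite_content_axioms M null_quotient.intro) auto
  define q where "q A = {s. range s \<subseteq> carrier L \<and>
    (\<lambda>n. measure M (sym_diff (stone L (s n)) A)) \<longlonglongrightarrow> 0}" for A
  have q_le: "q A \<subseteq> q D"
    if A: "A \<in> sets M" and D: "D \<in> sets M" and null: "sym_diff A D \<in> null_sets M" for A D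
  proof
    fix s assume s: "s \<in> q A"
    then have sc: "s n \<in> carrier L" for n by (auto simp: q_def)
    have lim: "(\<lambda>n. measure M (sym_diff (stone L (s n)) A)) \<longlonglongrightarrow> 0"
      using s by (simp add: q_def)
    have "measure M (sym_diff (stone L (s n)) D)
        \<le> measure M (sym_diff (stone L (s n)) A)" for n
      using measure_symm_diff_triangle[OF S.stone_sets[OF sc[of n]] A D] null
      by (simp add: measure_def null_setsD1)
    then have "(\<lambda>n. measure M (sym_diff (stone L (s n)) D)) \<longlonglongrightarrow> 0"
      by (intro tendsto_0_le[OF lim, where K = 1]) simp
    with s show "s \<in> q D" by (simp add: q_def)
  qed
  have q_null: "sym_diff A D \<in> null_sets M"
    if A: "A \<in> sets M" and D: "D \<in> sets M" and eq: "q A = q D" for A D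
  proof -
    have "\<exists>b. b \<in> carrier L \<and>
        measure M (sym_diff (stone L b) A) < inverse (real (Suc n))" for n
      using S.stone_dense[OF A, of "inverse (real (Suc n))"] by auto
    then obtain s where s: "\<And>n. s n \<in> carrier L"
        "\<And>n. measure M (sym_diff (stone L (s n)) A) < inverse (real (Suc n))"
      by metis
    have "(\<lambda>n. measure M (sym_diff (stone L (s n)) A)) \<longlonglongrightarrow> 0"
      using s(2) by (intro tendsto_0_le[OF LIMSEQ_inverse_real_of_nat, where K = 1]) (simp add: less_imp_le)
    then have lim: "s \<in> q A" using s(1) by (auto simp: q_def)
    then have "(\<lambda>n. measure M (sym_diff (stone L (s n)) A) +
        measure M (sym_diff (stone L (s n)) D)) \<longlonglongrightarrow> 0 + 0"
      using eq unfolding q_def by (intro tendsto_add) auto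
    moreover have "measure M (sym_diff A D) \<le>
        measure M (sym_diff (stone L (s n)) A) +
        measure M (sym_diff (stone L (s n)) D)" for n
      using measure_symm_diff_triangle[OF A S.stone_sets[OF s(1)[of n]] D]
      by (simp add: Un_commute)
    ultimately have "measure M (sym_diff A D) \<le> 0"
      by (intro LIMSEQ_le_const) auto
    then have "emeasure M (sym_diff A D) = 0"
      using measure_nonneg[of M "sym_diff A D"] by (simp add: emeasure_eq_measure)
    then show ?thesis using A D by (intro null_setsI) auto
  qed
  have null_sub: "D \<in> null_sets M" if "A \<in> null_sets M" "D \<in> sets M" "D \<subseteq> A" for A D
    using emeasure_mono[of D A M] that by (auto simp: null_sets_def)
  have split: "sym_diff A D \<in> null_sets M \<longleftrightarrow> A - D \<in> null_sets M \<and> D - A \<in> null_sets M"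
    if "A \<in> sets M" "D \<in> sets M" for A D
    using that null_sub[of "sym_diff A D" "A - D"] null_sub[of "sym_diff A D" "D - A"]
    by (auto intro: null_sets.Un)
  have q_eq: "q A = q D \<longleftrightarrow> A - D \<in> null_sets M \<and> D - A \<in> null_sets M"
    if "A \<in> sets M" "D \<in> sets M" for A D
    unfolding split[OF that, symmetric]
    using q_null[OF that] q_le[OF that] q_le[OF that(2,1)] by (auto simp: Un_commute)
  interpret N: stone_quotient L \<mu> M "null_sets M" q
  proof (intro stone_quotient.intro finite_content_axioms M null_quotient.intro q_eq)
    show "D \<in> null_sets M" if "A \<in> null_sets M" "D \<in> sets M" "D \<subseteq> A" for A D
      using that by (rule null_sub)
    show "\<Union>\<A> \<in> null_sets M" if "countable \<A>" "\<A> \<subseteq> null_sets M" for \<A>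
      using that null_sets_UN'[of \<A> "\<lambda>A. A" M] by auto
  qed auto
  have "reduced_completion L \<mu> (\<lambda>b. q (stone L b)) N.quot N.quotient_measure"
    by (simp add: reduced_completion_iff N.sigma_extension_quotient N.reduced_quotient)
  then show ?thesis by blast
qed

text \<open>
  For uniqueness of the isomorphism: two of them agree on the image of \<open>B\<close>, which generates, hence
  on the whole carrier, and extensionality fixes their values elsewhere.
\<close>

theorem corollary15:
  fixes B :: "'a gorder" and \<mu>\<^sub>0 :: "'a \<Rightarrow> ennreal"
  assumes "boolean_lattice B"
    and "additive_on B \<mu>\<^sub>0"
    and "\<forall>b\<in>carrier B. \<mu>\<^sub>0 b \<le> 1"
  shows "(\<exists>(B' :: (nat \<Rightarrow> 'a) set gorder) \<beta> \<mu>'. reduced_completion B \<mu>\<^sub>0 \<beta> B' \<mu>') \<and>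
    (\<forall>(B\<^sub>1 :: 'b gorder) \<beta>\<^sub>1 \<mu>\<^sub>1 (B\<^sub>2 :: 'c gorder) \<beta>\<^sub>2 \<mu>\<^sub>2.
      reduced_completion B \<mu>\<^sub>0 \<beta>\<^sub>1 B\<^sub>1 \<mu>\<^sub>1 \<and> reduced_completion B \<mu>\<^sub>0 \<beta>\<^sub>2 B\<^sub>2 \<mu>\<^sub>2 \<longrightarrow>
      (\<exists>!\<phi>. \<phi> \<in> extensional (carrier B\<^sub>1) \<and> sigma_iso B\<^sub>1 B\<^sub>2 \<phi> \<and>
        (\<forall>b\<in>carrier B. \<phi> (\<beta>\<^sub>1 b) = \<beta>\<^sub>2 b) \<and>
        (\<forall>x\<in>carrier B\<^sub>1. \<mu>\<^sub>2 (\<phi> x) = \<mu>\<^sub>1 x)))"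
proof (intro conjI allI impI)
  interpret B0: boolean_lattice B by fact
  have "\<mu>\<^sub>0 \<top>\<^bsub>B\<^esub> < \<infinity>"
    using assms(3) B0.top_closed ennreal_one_less_top order_le_less_trans by (metis infinity_ennreal_def)
  then interpret B: finite_content B \<mu>\<^sub>0
    using assms(2) by unfold_locales
  show "\<exists>(B' :: (nat \<Rightarrow> 'a) set gorder) \<beta> \<mu>'. reduced_completion B \<mu>\<^sub>0 \<beta> B' \<mu>'"
    by (rule B.reduced_completion_exists)
  fix B1 :: "'b gorder" and \<beta>1 \<mu>1 and B2 :: "'c gorder" and \<beta>2 \<mu>2
  assume "reduced_completion B \<mu>\<^sub>0 \<beta>1 B1 \<mu>1 \<and> reduced_completion B \<mu>\<^sub>0 \<beta>2 B2 \<mu>2"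
  then have ext: "sigma_extension B \<mu>\<^sub>0 \<beta>1 B1 \<mu>1" "sigma_extension B \<mu>\<^sub>0 \<beta>2 B2 \<mu>2"
    and red: "reduced B1 \<mu>1" "reduced B2 \<mu>2"
    by (auto simp: reduced_completion_iff)
  interpret P: extension_pair B \<mu>\<^sub>0 B1 \<beta>1 \<mu>1 B2 \<beta>2 \<mu>2
    by (rule extension_pair.intro[OF B.finite_content_axioms ext])
  let ?P = "\<lambda>\<phi>. \<phi> \<in> extensional (carrier B1) \<and> sigma_iso B1 B2 \<phi> \<and>
    (\<forall>b\<in>carrier B. \<phi> (\<beta>1 b) = \<beta>2 b) \<and> (\<forall>x\<in>carrier B1. \<mu>2 (\<phi> x) = \<mu>1 x)"
  obtain \<phi> where "\<phi> \<in> extensional (carrier B1)" "sigma_iso B1 B2 \<phi>"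
    "\<forall>b\<in>carrier B. \<phi> (\<beta>1 b) = \<beta>2 b" "\<forall>x\<in>carrier B1. \<mu>2 (\<phi> x) = \<mu>1 x"
    by (rule P.isomorphism_exists[OF red])
  then have \<phi>: "?P \<phi>" by blast
  show "\<exists>!\<phi>. ?P \<phi>"
  proof (rule ex1I[where a = \<phi>])
    show "?P \<phi>" by (rule \<phi>)
  next
    fix \<psi> assume \<psi>: "?P \<psi>"
    have gen: "sigma_generated_by B1 (\<beta>1 ` carrier B)"
      using ext by (simp add: sigma_extension_def)
    have "\<psi> x = \<phi> x" if "x \<in> carrier B1" for x
      by (rule sigma_hom_agree_on_generators[OF gen P.C1.abstract_sigma_algebra_axioms _ _ _ that,
            where M = B2])
        (use \<phi> \<psi> in \<open>auto simp: sigma_iso_def\<close>)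
    with \<phi> \<psi> show "\<psi> = \<phi>"
      by (intro extensionalityI[of _ "carrier B1"]) auto
  qed
qed

end
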